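(* Let $R\in\operatorname{Ob}(\hat{\mathcal C})$, $n\ge 4$, $G=\mathrm{SL}_n(R)$, $\bar\rho:G\to\mathrm{GL}_n(k)$ induced by reduction $R\twoheadrightarrow k$, and $\iota:G\hookrightarrow\mathrm{GL}_n(R)$ the inclusion. Then $\iota$ is a universal lift of $\bar\rho$; in particular $R$ is the universal deformation ring of $\bar\rho$.
   Context: Let $k$ be a finite field of characteristic $p$. $\hat{\mathcal C}$ is the category of complete noetherian local commutative rings with residue field $k$, with local homomorphisms inducing the identity on $k$; $\mathfrak m_S$ is the maximal ideal of $S$. For a profinite group $G$ and continuous $\bar\rho:G\to\mathrm{GL}_n(k)$, a lift to $S\in\hat{\mathcal C}$ is a continuous $\rho:G\to\mathrm{GL}_n(S)$ reducing to $\bar\rho$; lifts $\rho,\rho'$ are strictly equivalent if $\rho'=K\rho K^{-1}$ with $K\in I+M_n(\mathfrak m_S)$; $\mathrm{Def}_{\bar\rho}(S)$ is the set of strict equivalence classes $[\rho]$, a functor via $[\rho]\mapsto[\mathrm{GL}_n(f)\circ\rho]$ ($\mathrm{GL}_n(f)$ applies $f$ entrywise). A lift $\rho$ of $\bar\rho$ to $R$ is universal if the natural transformation $\rho_*:\mathrm{Hom}_{\hat{\mathcal C}}(R,-)\to\mathrm{Def}_{\bar\rho}$, $f\mapsto[\mathrm{GL}_n(f)\circ\rho]$, is a natural isomorphism; $R$ is then the universal deformation ring. $\mathrm{SL}_n(R)$ has the profinite topology as $\varprojlim_j\mathrm{SL}_n(R/\mathfrak m_R^j)$. *)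

theory Defs
  imports "Jordan_Normal_Form.Determinant"
begin

definition is_ring_hom :: "('a::comm_ring_1 \<Rightarrow> 'b::comm_ring_1) \<Rightarrow> bool" where
  "is_ring_hom f \<longleftrightarrow> f 1 = 1 \<and> (\<forall>a b. f (a + b) = f a + f b) \<and> (\<forall>a b. f (a * b) = f a * f b)"

definition is_ideal :: "'a::comm_ring_1 set \<Rightarrow> bool" where
  "is_ideal I \<longleftrightarrow> 0 \<in> I \<and> (\<forall>a\<in>I. \<forall>b\<in>I. a + b \<in> I) \<and> (\<forall>a\<in>I. \<forall>r. r * a \<in> I)"

definition maximal_ideal :: "'a::comm_ring_1 set \<Rightarrow> bool" where
  "maximal_ideal M \<longleftrightarrow> is_ideal M \<and> M \<noteq> UNIV \<and>
     (\<forall>J. is_ideal J \<and> M \<subseteq> J \<longrightarrow> J = M \<or> J = UNIV)"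

definition local_ring :: "'a::comm_ring_1 itself \<Rightarrow> bool" where
  "local_ring _ \<longleftrightarrow> (\<exists>!M::'a set. maximal_ideal M)"

definition noetherian_ring :: "'a::comm_ring_1 itself \<Rightarrow> bool" where
  "noetherian_ring _ \<longleftrightarrow> (\<forall>I::nat \<Rightarrow> 'a set. (\<forall>i. is_ideal (I i)) \<and> (\<forall>i. I i \<subseteq> I (Suc i))
      \<longrightarrow> (\<exists>N. \<forall>i\<ge>N. I i = I N))"

inductive_set add_closure :: "'a::comm_ring_1 set \<Rightarrow> 'a set" for A where
  zero: "0 \<in> add_closure A"
| base: "a \<in> A \<Longrightarrow> a \<in> add_closure A"
| add: "a \<in> add_closure A \<Longrightarrow> b \<in> add_closure A \<Longrightarrow> a + b \<in> add_closure A"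

fun ideal_pow :: "'a::comm_ring_1 set \<Rightarrow> nat \<Rightarrow> 'a set" where
  "ideal_pow M 0 = UNIV"
| "ideal_pow M (Suc j) = add_closure {a * b | a b. a \<in> M \<and> b \<in> ideal_pow M j}"

text \<open>M-adic completeness (and separatedness): the canonical map
  S \<rightarrow> lim S/M^j is bijective; a compatible family in the inverse limit is
  represented by a sequence x with x (j+1) \<equiv> x j mod M^j.\<close>
definition adically_complete :: "'a::comm_ring_1 set \<Rightarrow> bool" where
  "adically_complete M \<longleftrightarrow> (\<forall>x::nat \<Rightarrow> 'a. (\<forall>j. x (Suc j) - x j \<in> ideal_pow M j)
      \<longrightarrow> (\<exists>!y. \<forall>j. y - x j \<in> ideal_pow M j))"

text \<open>Objects of C-hat: a ring S (the type 's) together with the reduction map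
  \<pi> : S \<rightarrow> k identifying its residue field with k.\<close>
definition max_id :: "('s::comm_ring_1 \<Rightarrow> 'k::field) \<Rightarrow> 's set" where
  "max_id \<pi> = {a. \<pi> a = 0}"

definition Chat_obj :: "('s::comm_ring_1 \<Rightarrow> 'k::field) \<Rightarrow> bool" where
  "Chat_obj \<pi> \<longleftrightarrow> is_ring_hom \<pi> \<and> surj \<pi> \<and> local_ring TYPE('s) \<and> noetherian_ring TYPE('s)
     \<and> adically_complete (max_id \<pi>)"

definition Chat_hom :: "('r::comm_ring_1 \<Rightarrow> 'k::field) \<Rightarrow> ('s::comm_ring_1 \<Rightarrow> 'k) \<Rightarrow> ('r \<Rightarrow> 's) \<Rightarrow> bool" where
  "Chat_hom \<pi>R \<pi>S f \<longleftrightarrow> is_ring_hom f \<and> f ` max_id \<pi>R \<subseteq> max_id \<pi>S \<and> (\<forall>a. \<pi>S (f a) = \<pi>R a)"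

definition SL :: "nat \<Rightarrow> 'a::comm_ring_1 mat set" where
  "SL n = {A \<in> carrier_mat n n. det A = 1}"

definition GL :: "nat \<Rightarrow> 'a::comm_ring_1 mat set" where
  "GL n = {A \<in> carrier_mat n n. invertible_mat A}"

definition mat_cong :: "nat \<Rightarrow> 'a::comm_ring_1 set \<Rightarrow> 'a mat \<Rightarrow> 'a mat \<Rightarrow> bool" where
  "mat_cong n I A B \<longleftrightarrow> (\<forall>a<n. \<forall>b<n. A $$ (a, b) - B $$ (a, b) \<in> I)"

text \<open>Continuity of \<rho> : SL_n(R) \<rightarrow> GL_n(S), with the profinite topology on SL_n(R)
  (basic neighbourhoods of g: matrices congruent to g mod m_R^i) and the m_S-adic
  topology on GL_n(S).\<close>
definition cont_rep :: "nat \<Rightarrow> ('r::comm_ring_1 \<Rightarrow> 'k::field) \<Rightarrow> ('s::comm_ring_1 \<Rightarrow> 'k)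
    \<Rightarrow> ('r mat \<Rightarrow> 's mat) \<Rightarrow> bool" where
  "cont_rep n \<pi>R \<pi>S \<rho> \<longleftrightarrow> (\<forall>g\<in>SL n. \<forall>j. \<exists>i. \<forall>h\<in>SL n.
     mat_cong n (ideal_pow (max_id \<pi>R) i) h g \<longrightarrow> mat_cong n (ideal_pow (max_id \<pi>S) j) (\<rho> h) (\<rho> g))"

definition is_lift :: "nat \<Rightarrow> ('r::comm_ring_1 \<Rightarrow> 'k::field) \<Rightarrow> ('s::comm_ring_1 \<Rightarrow> 'k)
    \<Rightarrow> ('r mat \<Rightarrow> 's mat) \<Rightarrow> bool" where
  "is_lift n \<pi>R \<pi>S \<rho> \<longleftrightarrow> (\<forall>g\<in>SL n. \<rho> g \<in> GL n) \<and> (\<forall>g\<in>SL n. \<forall>h\<in>SL n. \<rho> (g * h) = \<rho> g * \<rho> h)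
     \<and> cont_rep n \<pi>R \<pi>S \<rho> \<and> (\<forall>g\<in>SL n. map_mat \<pi>S (\<rho> g) = map_mat \<pi>R g)"

definition lifts :: "nat \<Rightarrow> ('r::comm_ring_1 \<Rightarrow> 'k::field) \<Rightarrow> ('s::comm_ring_1 \<Rightarrow> 'k)
    \<Rightarrow> ('r mat \<Rightarrow> 's mat) set" where
  "lifts n \<pi>R \<pi>S = {\<rho>. is_lift n \<pi>R \<pi>S \<rho>}"

definition strict_equiv :: "nat \<Rightarrow> ('r::comm_ring_1 \<Rightarrow> 'k::field) \<Rightarrow> ('s::comm_ring_1 \<Rightarrow> 'k)
    \<Rightarrow> (('r mat \<Rightarrow> 's mat) \<times> ('r mat \<Rightarrow> 's mat)) set" where
  "strict_equiv n \<pi>R \<pi>S = {(\<rho>, \<rho>'). \<rho> \<in> lifts n \<pi>R \<pi>S \<and> \<rho>' \<in> lifts n \<pi>R \<pi>S \<and>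
     (\<exists>K Kinv. K \<in> carrier_mat n n \<and> Kinv \<in> carrier_mat n n \<and> K * Kinv = 1\<^sub>m n \<and> Kinv * K = 1\<^sub>m n
        \<and> mat_cong n (max_id \<pi>S) K (1\<^sub>m n) \<and> (\<forall>g\<in>SL n. \<rho>' g = K * \<rho> g * Kinv))}"

definition Def_functor :: "nat \<Rightarrow> ('r::comm_ring_1 \<Rightarrow> 'k::field) \<Rightarrow> ('s::comm_ring_1 \<Rightarrow> 'k)
    \<Rightarrow> ('r mat \<Rightarrow> 's mat) set set" where
  "Def_functor n \<pi>R \<pi>S = lifts n \<pi>R \<pi>S // strict_equiv n \<pi>R \<pi>S"

definition push_class :: "nat \<Rightarrow> ('r::comm_ring_1 \<Rightarrow> 'k::field) \<Rightarrow> ('s::comm_ring_1 \<Rightarrow> 'k)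
    \<Rightarrow> ('r mat \<Rightarrow> 'r mat) \<Rightarrow> ('r \<Rightarrow> 's) \<Rightarrow> ('r mat \<Rightarrow> 's mat) set" where
  "push_class n \<pi>R \<pi>S \<rho> f = strict_equiv n \<pi>R \<pi>S `` {(\<lambda>g. map_mat f (\<rho> g))}"

end

(*
Write t_ij(r) for the elementary matrices and X_ij(r) = \<rho>(t_ij(r)) - 1, X_ij = X_ij(1), for a lift \<rho> to S;
modulo the maximal ideal m of S the X_ij are the matrix units E_ij.

Commutants can be computed modulo m: for disjoint index sets A, B, a matrix over S commuting with all X_kl,
k not in B, l not in A, is a combination of 1 and the X_ab with a in A, b in B. Hence X_ij(r) = a + b X_ij,
and X_ij(r) X_il = \<alpha> + \<beta> X_ij + \<gamma> X_il. Bracketing the latter with X_lk(q), for a fourth index k,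
gives X_ij(r) X_ik(q) = \<gamma> X_ik(q); exchanging the roles of j and k, this product is also a multiple of X_ij(r),
so it vanishes by linear independence. Continuing in this way all relations X_ij X_kl = \<delta>_jk X_il follow,
and X_ij(r) = f(r) X_ij where f is additive by t_ij(r) t_ij(s) = t_ij(r + s) and multiplicative by the
commutator relation. A column of each X_i1 then gives a matrix K congruent to 1 mod m that conjugates every
X_ij to E_ij. As SL_n(R) is generated by elementary matrices, \<rho> = K f K^{-1}.

Conversely f is recovered from its strict equivalence class by comparing the entries of
K f(t_12(r)) = f'(t_12(r)) K.
*)
theory Submission
  imports Defs
begin

section \<open>Ideals and complete local rings\<close>

lemma is_idealD:
  assumes "is_ideal I"
  shows "0 \<in> I" "a \<in> I \<Longrightarrow> b \<in> I \<Longrightarrow> a + b \<in> I" "a \<in> I \<Longrightarrow> r * a \<in> I"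
    "a \<in> I \<Longrightarrow> - a \<in> I" "a \<in> I \<Longrightarrow> b \<in> I \<Longrightarrow> a - b \<in> I"
proof -
  show *: "0 \<in> I" "\<And>a b. a \<in> I \<Longrightarrow> b \<in> I \<Longrightarrow> a + b \<in> I" "\<And>a r. a \<in> I \<Longrightarrow> r * a \<in> I"
    using assms by (auto simp: is_ideal_def)
  show neg: "\<And>a. a \<in> I \<Longrightarrow> - a \<in> I" using *(3)[of _ "- 1"] by simp
  show "\<And>a b. a \<in> I \<Longrightarrow> b \<in> I \<Longrightarrow> a - b \<in> I" using *(2) neg by (metis diff_conv_add_uminus)
qed

lemma is_ideal_sum:
  assumes "is_ideal I" "\<And>x. x \<in> A \<Longrightarrow> f x \<in> I"
  shows "sum f A \<in> I"
  using assms(2) by (induction A rule: infinite_finite_induct) (auto intro: is_idealD[OF assms(1)])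

text \<open>\<open>add_closure\<close> only forms finite sums. A factor r is absorbed into the
  second factor of each generator, which ranges over an ideal by induction.\<close>

lemma is_ideal_pow: "is_ideal (ideal_pow M j)"
proof (induction j)
  case 0
  show ?case by (simp add: is_ideal_def)
next
  case (Suc j)
  have "r * a \<in> ideal_pow M (Suc j)" if "a \<in> ideal_pow M (Suc j)" for r a
    using that unfolding ideal_pow.simps
  proof induction
    case (base x)
    then obtain u v where "x = u * v" "u \<in> M" "v \<in> ideal_pow M j" by blast
    then have "r * x = u * (r * v)" "r * v \<in> ideal_pow M j"
      using is_idealD(3)[OF Suc.IH] by (simp_all add: mult.left_commute)
    then show ?case using \<open>u \<in> M\<close> by (blast intro: add_closure.base)
  qed (auto simp: distrib_left intro: add_closure.intros)
  then show ?case by (auto simp: is_ideal_def intro: add_closure.intros)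
qed

lemma ideal_pow_mult: "a \<in> M \<Longrightarrow> b \<in> ideal_pow M j \<Longrightarrow> a * b \<in> ideal_pow M (Suc j)"
  by (auto intro: add_closure.base)

lemma ring_hom_image_ideal_pow:
  assumes "is_ring_hom f" "f ` M \<subseteq> N" "a \<in> ideal_pow M j"
  shows "f a \<in> ideal_pow N j"
  using assms(3)
proof (induction j arbitrary: a)
  case (Suc j)
  have f0: "f 0 = 0" using assms(1) unfolding is_ring_hom_def by (metis add_cancel_left_left)
  show ?case using Suc.prems unfolding ideal_pow.simps
  proof induction
    case zero
    then show ?case by (simp add: f0 add_closure.zero)
  next
    case (base x)
    then obtain u v where "x = u * v" "u \<in> M" "v \<in> ideal_pow M j" by blast
    then have "f x = f u * f v" "f u \<in> N" "f v \<in> ideal_pow N j"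
      using assms(1,2) Suc.IH by (auto simp: is_ring_hom_def)
    then show ?case by (blast intro: add_closure.base)
  next
    case (add x y)
    then show ?case using assms(1) by (simp add: is_ring_hom_def add_closure.add)
  qed
qed simp

lemma is_ring_hom_comm_ring_hom: "is_ring_hom f \<Longrightarrow> comm_ring_hom f"
  by unfold_locales (auto simp: is_ring_hom_def, metis add_cancel_left_left)

section \<open>Units and linear equations in a complete local ring\<close>

locale chat_ring =
  fixes \<pi> :: "'s::comm_ring_1 \<Rightarrow> 'k::field"
  assumes obj: "Chat_obj \<pi>"
begin

sublocale comm_ring_hom \<pi>
  using obj by (auto simp: Chat_obj_def intro: is_ring_hom_comm_ring_hom)

definition mpow :: "nat \<Rightarrow> 's set" where
  "mpow j = ideal_pow (max_id \<pi>) j"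

lemma is_ideal_mpow: "is_ideal (mpow j)"
  by (simp add: mpow_def is_ideal_pow)

lemmas mpow_zero = is_idealD(1)[OF is_ideal_mpow]
  and mpow_add = is_idealD(2)[OF is_ideal_mpow]
  and mpow_mult_left = is_idealD(3)[OF is_ideal_mpow]
  and mpow_uminus = is_idealD(4)[OF is_ideal_mpow]
  and mpow_diff = is_idealD(5)[OF is_ideal_mpow]
  and mpow_sum = is_ideal_sum[OF is_ideal_mpow]

lemma mpow_Suc: "\<pi> a = 0 \<Longrightarrow> b \<in> mpow j \<Longrightarrow> a * b \<in> mpow (Suc j)" "\<pi> a = 0 \<Longrightarrow> b \<in> mpow j \<Longrightarrow> b * a \<in> mpow (Suc j)"
  using ideal_pow_mult[of a "max_id \<pi>" b j] by (simp_all add: mpow_def max_id_def mult.commute del: ideal_pow.simps)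

text \<open>The uniqueness half of \<open>adically_complete\<close>: an element of all powers and 0
  are both limits of the constant sequence 0.\<close>

lemma separated:
  assumes "\<And>j. a \<in> mpow j"
  shows "a = 0"
proof -
  have "adically_complete (max_id \<pi>)" using obj by (simp add: Chat_obj_def)
  from this[unfolded adically_complete_def, rule_format, of "\<lambda>_. 0"]
  have "\<exists>!y. \<forall>j. y \<in> mpow j"
    using mpow_zero by (simp add: mpow_def)
  then show ?thesis using assms mpow_zero by blast
qed

text \<open>The start is free since \<open>mpow 0\<close> is the whole ring. This lifts vanishing
  modulo m to vanishing in S, raising the exponent by one for a whole family of elements at
  once.\<close>

lemma separated_induct:
  assumes "\<And>j. (\<forall>x\<in>A. f x \<in> mpow j) \<Longrightarrow> \<forall>x\<in>A. f x \<in> mpow (Suc j)" "x \<in> A"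
  shows "f x = 0"
proof (rule separated)
  fix j
  have "\<forall>x\<in>A. f x \<in> mpow j"
    by (induction j) (use assms(1) in \<open>auto simp: mpow_def\<close>)
  then show "f x \<in> mpow j" using assms(2) by blast
qed

text \<open>Geometric series: if y lifts the inverse of the residue of x, then x * y = 1 - m with m
  in the maximal ideal, and the partial sums of the powers of m converge to an inverse of 1 -
  m.\<close>

lemma unit_iff: "(\<exists>w. x * w = 1) \<longleftrightarrow> \<pi> x \<noteq> 0"
proof
  assume "\<exists>w. x * w = 1"
  then obtain w where "x * w = 1" by blast
  then have "\<pi> x * \<pi> w = 1" by (metis hom_mult hom_one)
  then show "\<pi> x \<noteq> 0" by auto
next
  assume x: "\<pi> x \<noteq> 0"
  obtain y where y: "\<pi> y = inverse (\<pi> x)"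
    using obj unfolding Chat_obj_def by (metis surjD)
  define m where "m = 1 - x * y"
  have m: "\<pi> m = 0" using x y by (simp add: m_def hom_minus hom_mult)
  have mj: "m ^ j \<in> mpow j" for j
    by (induction j) (auto simp: mpow_Suc[OF m], simp add: mpow_def)
  define s where "s j = (\<Sum>i<j. m ^ i)" for j
  have "s (Suc j) - s j \<in> mpow j" for j using mj by (simp add: s_def)
  then obtain z where z: "\<And>j. z - s j \<in> mpow j"
    using obj unfolding Chat_obj_def adically_complete_def mpow_def by metis
  have "(1 - m) * z - 1 = 0"
  proof (rule separated)
    fix j
    have "(1 - m) * s j = 1 - m ^ j" unfolding s_def by (simp add: one_diff_power_eq)
    then have "(1 - m) * z - 1 = (1 - m) * (z - s j) - m ^ j" by (simp add: algebra_simps)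
    then show "(1 - m) * z - 1 \<in> mpow j" using z mj by (simp add: mpow_diff mpow_mult_left)
  qed
  then have "x * (y * z) = 1" by (simp add: m_def algebra_simps)
  then show "\<exists>w. x * w = 1" by blast
qed

text \<open>Gaussian elimination on a system whose matrix is the identity modulo m, so that every
  pivot is a unit.\<close>

lemma solve_near_identity:
  fixes Y :: "'i \<Rightarrow> 'i \<Rightarrow> 's"
  assumes "finite G" "\<And>f g. f \<in> G \<Longrightarrow> g \<in> G \<Longrightarrow> \<pi> (Y f g) = (if f = g then 1 else 0)"
  shows "\<exists>d. \<forall>g\<in>G. M g = (\<Sum>f\<in>G. d f * Y f g)"
  using assms
proof (induction G arbitrary: Y M rule: finite_induct)
  case (insert h G)
  have "\<pi> (Y h h) \<noteq> 0" using insert.prems by simp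
  then obtain w where w: "Y h h * w = 1" using unit_iff by blast
  \<comment> \<open>The equation at h is solved for the unknown at h and substituted into the
    others. This Schur complement is again residually the identity, because \<open>Y f h\<close>
    lies in m for f in G.\<close>
  define Y' where "Y' f g = Y f g - Y f h * w * Y h g" for f g
  define M' where "M' g = M g - M h * w * Y h g" for g
  have "\<pi> (Y' f g) = (if f = g then 1 else 0)" if "f \<in> G" "g \<in> G" for f g
    using that insert.prems[of f g] insert.prems[of f h] insert.hyps(2)
    by (auto simp: Y'_def hom_minus hom_mult)
  from insert.IH[OF this] obtain d where d: "\<And>g. g \<in> G \<Longrightarrow> M' g = (\<Sum>f\<in>G. d f * Y' f g)" by blast
  \<comment> \<open>Back substitution: the equation at h forces this value of the unknown at
    h.\<close>
  define t where "t = (M h - (\<Sum>f\<in>G. d f * Y f h)) * w"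
  define d' where "d' = d(h := t)"
  have sum: "(\<Sum>f\<in>insert h G. d' f * Y f g) = t * Y h g + (\<Sum>f\<in>G. d f * Y f g)" for g
    using insert.hyps by (simp add: d'_def) (rule sum.cong, auto)
  have "M g = (\<Sum>f\<in>insert h G. d' f * Y f g)" if "g \<in> insert h G" for g
  proof (cases "g = h")
    case True
    have "t * Y h h = (M h - (\<Sum>f\<in>G. d f * Y f h)) * (Y h h * w)" by (simp add: t_def ac_simps)
    then show ?thesis unfolding sum True by (simp add: w)
  next
    case False
    then have "M' g = (\<Sum>f\<in>G. d f * Y' f g)" using d that by blast
    also have "\<dots> = (\<Sum>f\<in>G. d f * Y f g) - (\<Sum>f\<in>G. d f * Y f h) * w * Y h g"
      by (simp add: Y'_def sum_distrib_right flip: sum_subtractf) (rule sum.cong, auto simp: algebra_simps)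
    finally show ?thesis unfolding sum by (simp add: M'_def t_def algebra_simps)
  qed
  then show ?case by blast
qed simp

end

section \<open>Matrices in a ring type\<close>

text \<open>The type ignores the dimension n, so that the class ring_1 is available; n by n matrices sit in it as a
  corner, whose identity is not 1.\<close>

typedef (overloaded) 's seq_op = "{F :: (nat \<Rightarrow> 's::comm_ring_1) \<Rightarrow> nat \<Rightarrow> 's.
    \<forall>u v. F (\<lambda>i. u i + v i) = (\<lambda>i. F u i + F v i)}"
  by (rule exI[of _ "\<lambda>v. v"]) simp

setup_lifting type_definition_seq_op

instantiation seq_op :: (comm_ring_1) ring_1
begin

lift_definition zero_seq_op :: "'a seq_op" is "\<lambda>v i. 0" by simp
lift_definition one_seq_op :: "'a seq_op" is "\<lambda>v. v" by simp
lift_definition plus_seq_op :: "'a seq_op \<Rightarrow> 'a seq_op \<Rightarrow> 'a seq_op" is "\<lambda>F G v i. F v i + G v i"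
  by (simp add: algebra_simps)
lift_definition minus_seq_op :: "'a seq_op \<Rightarrow> 'a seq_op \<Rightarrow> 'a seq_op" is "\<lambda>F G v i. F v i - G v i"
  by (simp add: algebra_simps)
lift_definition uminus_seq_op :: "'a seq_op \<Rightarrow> 'a seq_op" is "\<lambda>F v i. - F v i"
  by (simp add: algebra_simps)
lift_definition times_seq_op :: "'a seq_op \<Rightarrow> 'a seq_op \<Rightarrow> 'a seq_op" is "\<lambda>F G v. F (G v)"
  by simp

instance
proof
  show "(0 :: 'a seq_op) \<noteq> 1"
  proof
    assume "(0 :: 'a seq_op) = 1"
    then have "(\<lambda>v i. 0) = (\<lambda>v :: nat \<Rightarrow> 'a. v)" by transfer
    from arg_cong[OF this, of "\<lambda>F. F (\<lambda>_. 1) 0"] show False by simp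
  qed
qed (transfer; simp add: algebra_simps)+

end

lift_definition mat_op :: "nat \<Rightarrow> 's::comm_ring_1 mat \<Rightarrow> 's seq_op" is
  "\<lambda>n A v i. if i < n then \<Sum>j<n. A $$ (i, j) * v j else 0"
  by (auto simp: distrib_left sum.distrib)

text \<open>Only additivity is required of a \<open>seq_op\<close>, so scalars are ring elements
  that need not be central; they do commute with the elements of \<open>mat_ops\<close>, by
  \<open>scal_commute\<close>.\<close>

lift_definition scal :: "'s::comm_ring_1 \<Rightarrow> 's seq_op" is "\<lambda>c v i. c * v i"
  by (simp add: distrib_left)

lift_definition entry :: "'s::comm_ring_1 seq_op \<Rightarrow> nat \<Rightarrow> nat \<Rightarrow> 's" is
  "\<lambda>F i j. F (\<lambda>k. if k = j then 1 else 0) i" .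

lemma scal_simps: "scal (a + b) = scal a + scal b" "scal (a - b) = scal a - scal b" "scal (a * b) = scal a * scal b"
  "scal 0 = 0" "scal 1 = 1" "scal (- a) = - scal a"
  by (transfer; simp add: algebra_simps fun_eq_iff)+

lemma entry_simps: "entry (F + G) i j = entry F i j + entry G i j" "entry (F - G) i j = entry F i j - entry G i j"
  "entry (scal c * F) i j = c * entry F i j" "entry 0 i j = 0"
  by (transfer; simp)+

lemma entry_sum: "entry (sum F I) i j = (\<Sum>x\<in>I. entry (F x) i j)"
  by (induction I rule: infinite_finite_induct) (auto simp: entry_simps)

lemma mat_op_add: "A \<in> carrier_mat n n \<Longrightarrow> B \<in> carrier_mat n n \<Longrightarrow> mat_op n (A + B) = mat_op n A + mat_op n B"
  by transfer (auto simp: fun_eq_iff distrib_right sum.distrib)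

lemma mat_op_diff: "A \<in> carrier_mat n n \<Longrightarrow> B \<in> carrier_mat n n \<Longrightarrow> mat_op n (A - B) = mat_op n A - mat_op n B"
  by transfer (auto simp: fun_eq_iff left_diff_distrib sum_subtractf)

lemma mat_op_smult: "A \<in> carrier_mat n n \<Longrightarrow> mat_op n (c \<cdot>\<^sub>m A) = scal c * mat_op n A"
  by transfer (auto simp: fun_eq_iff sum_distrib_left mult.assoc)

lemma scal_mat_op_commute: "mat_op n A * scal c = scal c * mat_op n A"
  by transfer (auto simp: fun_eq_iff sum_distrib_left ac_simps)

lemma index_mult_mat_sum:
  "A \<in> carrier_mat n n \<Longrightarrow> B \<in> carrier_mat n n \<Longrightarrow> i < n \<Longrightarrow> j < n \<Longrightarrow>
    (A * B) $$ (i, j) = (\<Sum>k<n. A $$ (i, k) * B $$ (k, j))"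
  by (simp add: scalar_prod_def lessThan_atLeast0)

lemma mat_op_mult:
  assumes "A \<in> carrier_mat n n" "B \<in> carrier_mat n n"
  shows "mat_op n (A * B) = mat_op n A * mat_op n B"
  using assms
proof transfer
  fix n and A B :: "'a mat"
  assume AB: "A \<in> carrier_mat n n" "B \<in> carrier_mat n n"
  have "(\<Sum>j<n. (A * B) $$ (i, j) * v j) = (\<Sum>k<n. A $$ (i, k) * (\<Sum>j<n. B $$ (k, j) * v j))"
    if "i < n" for i and v :: "nat \<Rightarrow> 'a"
  proof -
    have "(\<Sum>j<n. (A * B) $$ (i, j) * v j) = (\<Sum>j<n. \<Sum>k<n. A $$ (i, k) * B $$ (k, j) * v j)"
      using that by (intro sum.cong) (simp_all add: index_mult_mat_sum[OF AB] sum_distrib_right del: index_mult_mat)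
    also have "\<dots> = (\<Sum>k<n. \<Sum>j<n. A $$ (i, k) * B $$ (k, j) * v j)" by (rule sum.swap)
    finally show ?thesis by (simp add: sum_distrib_left mult.assoc)
  qed
  then show "(\<lambda>v i. if i < n then \<Sum>j<n. (A * B) $$ (i, j) * v j else 0) =
    (\<lambda>v i. if i < n then \<Sum>j<n. A $$ (i, j) * (if j < n then \<Sum>k<n. B $$ (j, k) * v k else 0) else 0)"
    by (auto simp: fun_eq_iff)
qed

lemma entry_mat_op: "i < n \<Longrightarrow> j < n \<Longrightarrow> entry (mat_op n A) i j = A $$ (i, j)"
  by (simp add: entry.rep_eq mat_op.rep_eq if_distrib[of "\<lambda>x. _ * x"] cong: if_cong)

lemma mat_op_cong: "(\<And>i j. i < n \<Longrightarrow> j < n \<Longrightarrow> A $$ (i, j) = B $$ (i, j)) \<Longrightarrow> mat_op n A = mat_op n B"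
  by transfer (auto simp: fun_eq_iff)

definition mat_ops :: "nat \<Rightarrow> 's::comm_ring_1 seq_op set" where
  "mat_ops n = mat_op n ` carrier_mat n n"

lemma mat_ops_closed:
  assumes "F \<in> mat_ops n" "G \<in> mat_ops n"
  shows "F + G \<in> mat_ops n" "F - G \<in> mat_ops n" "F * G \<in> mat_ops n"
  using assms unfolding mat_ops_def
  by (auto simp flip: mat_op_add mat_op_diff mat_op_mult intro!: imageI minus_carrier_mat)

lemma mat_ops_scal: "F \<in> mat_ops n \<Longrightarrow> scal c * F \<in> mat_ops n"
  unfolding mat_ops_def by (auto simp flip: mat_op_smult)

lemma mat_ops_zero: "0 \<in> mat_ops n"
proof -
  have "mat_op n (0\<^sub>m n n) = (0 :: 'a seq_op)" by transfer (auto simp: fun_eq_iff)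
  then show ?thesis unfolding mat_ops_def by (metis image_eqI zero_carrier_mat)
qed

lemma mat_ops_sum: "(\<And>x. x \<in> I \<Longrightarrow> F x \<in> mat_ops n) \<Longrightarrow> sum F I \<in> mat_ops n"
  by (induction I rule: infinite_finite_induct) (auto simp: mat_ops_zero mat_ops_closed)

lemma mat_ops_eqI:
  assumes "F \<in> mat_ops n" "G \<in> mat_ops n" "\<And>i j. i < n \<Longrightarrow> j < n \<Longrightarrow> entry F i j = entry G i j"
  shows "F = G"
  using assms unfolding mat_ops_def by (auto simp: entry_mat_op intro: mat_op_cong)

lemma entry_mult:
  assumes "F \<in> mat_ops n" "G \<in> mat_ops n" "i < n" "j < n"
  shows "entry (F * G) i j = (\<Sum>k<n. entry F i k * entry G k j)"
  using assms unfolding mat_ops_def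
  by (auto simp: entry_mat_op index_mult_mat_sum simp del: index_mult_mat simp flip: mat_op_mult)

lemma scal_commute: "F \<in> mat_ops n \<Longrightarrow> F * scal c = scal c * F"
  unfolding mat_ops_def by (auto simp: scal_mat_op_commute)

section \<open>Lifts and elementary matrices\<close>

text \<open>For distinct i and j, \<open>addrow_mat n r i j\<close> is t_ij(r). Reading the product
  as a row operation reduces the relations below to case distinctions on the row.\<close>

lemma index_addrow_mat_mult:
  assumes "A \<in> carrier_mat n m" "j < n" "x < n" "y < m"
  shows "(addrow_mat n r i j * A) $$ (x, y) = (if i = x then r * A $$ (j, y) + A $$ (x, y) else A $$ (x, y))"
  using assms by (subst addrow_mat[symmetric, OF assms(1,2)]) auto

lemma addrow_mat_mult_same:
  assumes "i < n" "j < n" "i \<noteq> j"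
  shows "addrow_mat n r i j * addrow_mat n s i j = addrow_mat n (r + s) i j"
  using assms by (intro eq_matI) (auto simp: index_addrow_mat_mult[of _ n n] simp del: index_mult_mat(1))

lemma addrow_mat_commute:
  assumes "i < n" "j < n" "i \<noteq> j" "k < n" "l < n" "k \<noteq> l" "j \<noteq> k" "i \<noteq> l"
  shows "addrow_mat n r i j * addrow_mat n s k l = addrow_mat n s k l * addrow_mat n r i j"
  using assms by (intro eq_matI)
    (auto simp: index_addrow_mat_mult[of _ n n] algebra_simps simp del: index_mult_mat(1))

text \<open>The Steinberg relation [t_ij(r), t_jk(s)] = t_ik(rs), written without inverses so that
  multiplicativity of a lift transports it directly.\<close>

lemma addrow_mat_commutator:
  assumes "i < n" "j < n" "k < n" "i \<noteq> j" "j \<noteq> k" "i \<noteq> k"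
  shows "addrow_mat n r i j * addrow_mat n s j k = addrow_mat n (r * s) i k * (addrow_mat n s j k * addrow_mat n r i j)"
  using assms by (intro eq_matI)
    (auto simp: index_addrow_mat_mult[of _ n n] mult_carrier_mat[of _ n n _ n] algebra_simps simp del: index_mult_mat(1))

lemma addrow_mat_in_SL: "i < n \<Longrightarrow> j < n \<Longrightarrow> i \<noteq> j \<Longrightarrow> addrow_mat n r i j \<in> SL n"
  by (simp add: SL_def det_addrow_mat)

lemma SL_mult: "g \<in> SL n \<Longrightarrow> h \<in> SL n \<Longrightarrow> g * h \<in> SL n"
  by (auto simp: SL_def det_mult)

text \<open>\<open>1 + mat_op n (A - 1\<^sub>m n)\<close> acts as A on the first n coordinates and
  as the identity on the others. This extension is multiplicative and sends the identity matrix to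
  1.\<close>

lemma mat_op_minus_one_mult:
  assumes "A \<in> carrier_mat n n" "B \<in> carrier_mat n n"
  shows "1 + mat_op n (A * B - 1\<^sub>m n) = (1 + mat_op n (A - 1\<^sub>m n)) * (1 + mat_op n (B - 1\<^sub>m n))"
proof -
  have "A * B \<in> carrier_mat n n" using assms by simp
  moreover have "mat_op n A * mat_op n (1\<^sub>m n) = mat_op n A" "mat_op n (1\<^sub>m n) * mat_op n B = mat_op n B"
    "mat_op n (1\<^sub>m n) * mat_op n (1\<^sub>m n) = mat_op n (1\<^sub>m n :: 'a mat)"
    using assms by (simp_all flip: mat_op_mult)
  ultimately show ?thesis using assms by (simp add: mat_op_diff mat_op_mult algebra_simps)
qed

section \<open>Root elements of a lift and the relations they inherit from the group\<close>

locale SL_rep = chat_ring \<pi> for \<pi> :: "'s::comm_ring_1 \<Rightarrow> 'k::field" +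
  fixes n :: nat and \<pi>R :: "'r::comm_ring_1 \<Rightarrow> 'k" and \<rho> :: "'r mat \<Rightarrow> 's mat"
  assumes n4: "n \<ge> 4"
    and \<pi>R_hom: "is_ring_hom \<pi>R"
    and \<rho>_GL: "g \<in> SL n \<Longrightarrow> \<rho> g \<in> GL n"
    and \<rho>_mult: "g \<in> SL n \<Longrightarrow> h \<in> SL n \<Longrightarrow> \<rho> (g * h) = \<rho> g * \<rho> h"
    and \<rho>_red: "g \<in> SL n \<Longrightarrow> map_mat \<pi> (\<rho> g) = map_mat \<pi>R g"
begin

lemma \<rho>_carrier: "g \<in> SL n \<Longrightarrow> \<rho> g \<in> carrier_mat n n"
  using \<rho>_GL by (simp add: GL_def)

text \<open>An idempotent that has an inverse is the identity.\<close>

lemma \<rho>_one: "\<rho> (1\<^sub>m n) = 1\<^sub>m n"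
proof -
  have one: "1\<^sub>m n \<in> SL n" by (simp add: SL_def)
  note c = \<rho>_carrier[OF one]
  obtain B where B: "\<rho> (1\<^sub>m n) * B = 1\<^sub>m n" "B * \<rho> (1\<^sub>m n) = 1\<^sub>m (dim_row B)"
    using \<rho>_GL[OF one] c by (auto simp: GL_def invertible_mat_def inverts_mat_def)
  \<comment> \<open>\<open>invertible_mat\<close> leaves the shape of the inverse open; the two
    identity products determine it.\<close>
  have Bc: "B \<in> carrier_mat n n"
    using arg_cong[OF B(1), of dim_col] arg_cong[OF B(2), of dim_col] c by auto
  have "\<rho> (1\<^sub>m n) * \<rho> (1\<^sub>m n) = \<rho> (1\<^sub>m n)" using \<rho>_mult[OF one one] by simp
  then have "\<rho> (1\<^sub>m n) * (\<rho> (1\<^sub>m n) * B) = \<rho> (1\<^sub>m n) * B"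
    using assoc_mult_mat[OF c c Bc] by simp
  then show ?thesis using B(1) c by simp
qed

definition X :: "nat \<Rightarrow> nat \<Rightarrow> 'r \<Rightarrow> 's seq_op" where
  "X i j r = mat_op n (\<rho> (addrow_mat n r i j) - 1\<^sub>m n)"

text \<open>The identity of the corner; it takes the place of 1 in linear combinations that have to
  stay in \<open>mat_ops n\<close>.\<close>

definition E :: "'s seq_op" where
  "E = mat_op n (1\<^sub>m n)"

lemma E_in: "E \<in> mat_ops n"
  by (auto simp: E_def mat_ops_def)

lemma E_mult: "F \<in> mat_ops n \<Longrightarrow> E * F = F" "F \<in> mat_ops n \<Longrightarrow> F * E = F"
  by (auto simp: E_def mat_ops_def simp flip: mat_op_mult)

lemma entry_E: "i < n \<Longrightarrow> j < n \<Longrightarrow> entry E i j = (if i = j then 1 else 0)"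
  by (simp add: E_def entry_mat_op)

lemma X_in: "i < n \<Longrightarrow> j < n \<Longrightarrow> i \<noteq> j \<Longrightarrow> X i j r \<in> mat_ops n"
  by (auto simp: X_def mat_ops_def intro!: imageI minus_carrier_mat)

lemma \<pi>_entry_X:
  assumes "i < n" "j < n" "i \<noteq> j" "a < n" "b < n"
  shows "\<pi> (entry (X i j r) a b) = (if a = i \<and> b = j then \<pi>R r else 0)"
proof -
  interpret R: comm_ring_hom \<pi>R using \<pi>R_hom by (rule is_ring_hom_comm_ring_hom)
  let ?g = "addrow_mat n r i j"
  have g: "?g \<in> SL n" using assms by (simp add: addrow_mat_in_SL)
  have "map_mat \<pi> (\<rho> ?g) $$ (a, b) = map_mat \<pi>R ?g $$ (a, b)" by (simp add: \<rho>_red[OF g])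
  then have "\<pi> (\<rho> ?g $$ (a, b)) = \<pi>R (?g $$ (a, b))"
    using \<rho>_carrier[OF g] assms by simp
  then show ?thesis using \<rho>_carrier[OF g] assms
    by (auto simp: X_def entry_mat_op hom_minus R.hom_add)
qed

lemma one_plus_X:
  assumes "i < n" "j < n" "i \<noteq> j" "k < n" "l < n" "k \<noteq> l"
  shows "(1 + X i j r) * (1 + X k l s) = 1 + mat_op n (\<rho> (addrow_mat n r i j * addrow_mat n s k l) - 1\<^sub>m n)"
  using assms by (simp add: X_def mat_op_minus_one_mult \<rho>_mult addrow_mat_in_SL \<rho>_carrier)

lemma X_add:
  assumes "i < n" "j < n" "i \<noteq> j"
  shows "(1 + X i j r) * (1 + X i j s) = 1 + X i j (r + s)"
  using assms by (simp add: one_plus_X addrow_mat_mult_same) (simp add: X_def)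

lemma X_zero: "X i j 0 = 0"
proof -
  have "addrow_mat n (0::'r) i j = 1\<^sub>m n" by (intro eq_matI) auto
  then have "X i j 0 = mat_op n (1\<^sub>m n) - mat_op n (1\<^sub>m n)" by (simp add: X_def \<rho>_one mat_op_diff)
  then show ?thesis by simp
qed

lemma X_inverse:
  assumes "i < n" "j < n" "i \<noteq> j"
  shows "(1 + X i j r) * (1 + X i j (- r)) = 1"
  by (simp add: X_add[OF assms] X_zero)

lemma X_commute:
  assumes "i < n" "j < n" "i \<noteq> j" "k < n" "l < n" "k \<noteq> l" "j \<noteq> k" "i \<noteq> l"
  shows "X i j r * X k l s = X k l s * X i j r"
  using one_plus_X[OF assms(1-6), of r s] one_plus_X[OF assms(4-6,1-3), of s r] addrow_mat_commute[OF assms, of r s]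
  by (simp add: algebra_simps) (metis add_left_cancel)

lemma X_commutator:
  assumes "i < n" "j < n" "k < n" "i \<noteq> j" "j \<noteq> k" "i \<noteq> k"
  shows "(1 + X i j r) * (1 + X j k s) = (1 + X i k (r * s)) * ((1 + X j k s) * (1 + X i j r))"
proof -
  let ?a = "addrow_mat n r i j" and ?b = "addrow_mat n s j k" and ?c = "addrow_mat n (r * s) i k"
  have SL: "?a \<in> SL n" "?b \<in> SL n" "?c \<in> SL n" "?b * ?a \<in> SL n"
    using assms by (auto intro: addrow_mat_in_SL SL_mult)
  have "(1 + X i j r) * (1 + X j k s) = 1 + mat_op n (\<rho> (?c * (?b * ?a)) - 1\<^sub>m n)"
    using assms by (subst one_plus_X) (auto simp: addrow_mat_commutator)
  also have "\<dots> = (1 + X i k (r * s)) * (1 + mat_op n (\<rho> (?b * ?a) - 1\<^sub>m n))"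
    unfolding \<rho>_mult[OF SL(3,4)] X_def by (rule mat_op_minus_one_mult) (intro \<rho>_carrier SL)+
  also have "1 + mat_op n (\<rho> (?b * ?a) - 1\<^sub>m n) = (1 + X j k s) * (1 + X i j r)"
    using assms by (subst one_plus_X) auto
  finally show ?thesis .
qed

end

section \<open>Commutants of sets of root elements\<close>

text \<open>Bracketing x y = p + s y with an h that commutes with x, p and s replaces y by [y, h].\<close>

lemma commutator_cancel:
  fixes x :: "'a::ring_1"
  assumes "x * h = h * x" "s * h = h * s" "p * h = h * p" "x * y = p + s * y"
    and "y * h - h * y = v * u" "u * u' = 1"
  shows "x * v = s * v"
proof -
  have "x * (y * h - h * y) = (x * y) * h - (x * h) * y" by (simp add: algebra_simps)
  also have "\<dots> = (x * y) * h - h * (x * y)" by (simp add: assms(1) mult.assoc)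
  also have "\<dots> = (p * h - h * p) + (s * y * h - (h * s) * y)" by (simp add: assms(4) algebra_simps)
  also have "\<dots> = s * (y * h - h * y)"
    unfolding assms(3) assms(2)[symmetric] by (simp add: algebra_simps)
  finally have "x * v * (u * u') = s * v * (u * u')" by (simp add: assms(5) flip: mult.assoc)
  then show ?thesis by (simp add: assms(6))
qed

context SL_rep
begin

text \<open>The bound n >= 4 enters here: three given indices always leave a fourth one
  free.\<close>

lemma fresh_index:
  assumes "length xs < 4"
  obtains l where "l < n" "l \<notin> set xs"
proof -
  have "card (set xs) < card {..<n}" using n4 assms card_length[of xs] by simp
  then have "\<not> {..<n} \<subseteq> set xs" by (meson card_mono finite_set not_less)
  then show ?thesis using that by blast
qed

text \<open>G differs from the matrix unit E_kl by entries in m, so modulo m^(j+1) a product with M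
  may be computed with E_kl: M E_kl has column k of M as its column l, and E_kl M has row l of M as
  its row k.\<close>

lemma entry_mult_near_unit:
  assumes "M \<in> mat_ops n" "G \<in> mat_ops n" "k < n" "l < n"
    and G: "\<And>a b. a < n \<Longrightarrow> b < n \<Longrightarrow> \<pi> (entry G a b) = (if a = k \<and> b = l then 1 else 0)"
    and M: "\<And>a b. a < n \<Longrightarrow> b < n \<Longrightarrow> entry M a b \<in> mpow j"
    and xy: "x < n" "y < n"
  shows "entry (M * G) x y - (if y = l then entry M x k else 0) \<in> mpow (Suc j)"
    and "entry (G * M) x y - (if x = k then entry M l y else 0) \<in> mpow (Suc j)"
proof -
  have "(if y = l then entry M x k else 0) = (\<Sum>c<n. entry M x c * (if c = k \<and> y = l then 1 else 0))"
    using \<open>k < n\<close> by (simp add: if_distrib[of "\<lambda>z. _ * z"] cong: if_cong)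
  then have "entry (M * G) x y - (if y = l then entry M x k else 0)
      = (\<Sum>c<n. entry M x c * (entry G c y - (if c = k \<and> y = l then 1 else 0)))"
    using assms by (simp add: entry_mult right_diff_distrib sum_subtractf)
  also have "\<dots> \<in> mpow (Suc j)"
    by (intro mpow_sum mpow_Suc(2)) (use G M xy in \<open>auto simp: hom_minus\<close>)
  finally show "entry (M * G) x y - (if y = l then entry M x k else 0) \<in> mpow (Suc j)" .
  have "(if x = k then entry M l y else 0) = (\<Sum>c<n. (if x = k \<and> c = l then 1 else 0) * entry M c y)"
    using \<open>l < n\<close> by (simp add: if_distrib[of "\<lambda>z. z * _"] cong: if_cong)
  then have "entry (G * M) x y - (if x = k then entry M l y else 0)
      = (\<Sum>c<n. (entry G x c - (if x = k \<and> c = l then 1 else 0)) * entry M c y)"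
    using assms by (simp add: entry_mult left_diff_distrib sum_subtractf)
  also have "\<dots> \<in> mpow (Suc j)"
    by (intro mpow_sum mpow_Suc(1)) (use G M xy in \<open>auto simp: hom_minus\<close>)
  finally show "entry (G * M) x y - (if x = k then entry M l y else 0) \<in> mpow (Suc j)" .
qed

lemma \<pi>R_one: "\<pi>R 1 = 1"
  using \<pi>R_hom by (simp add: is_ring_hom_def)

text \<open>If the entries of M lie in \<open>m^j\<close>, then [M, X k l 1] = [M, E_kl] modulo \<open>m^(j+1)\<close>, and the vanishing of the latter
  puts the entries of M into \<open>m^(j+1)\<close>.\<close>

lemma commutant_zero:
  assumes AB: "A \<subseteq> {..<n}" "B \<subseteq> {..<n}" "A \<inter> B = {}" "p \<in> A" "q \<in> B"
    and M: "M \<in> mat_ops n"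
    and comm: "\<And>k l. k < n \<Longrightarrow> l < n \<Longrightarrow> k \<noteq> l \<Longrightarrow> k \<notin> B \<Longrightarrow> l \<notin> A \<Longrightarrow> M * X k l 1 = X k l 1 * M"
    and zero: "\<And>a b. a \<in> A \<Longrightarrow> b \<in> B \<Longrightarrow> entry M a b = 0" "entry M p p = 0"
  shows "M = 0"
proof (rule mat_ops_eqI[OF M mat_ops_zero])
  fix x y assume "x < n" "y < n"
  have "(\<lambda>(x, y). entry M x y) (x, y) = 0"
  proof (rule separated_induct[where A = "{..<n} \<times> {..<n}"])
    fix j
    assume "\<forall>z\<in>{..<n} \<times> {..<n}. (case z of (x, y) \<Rightarrow> entry M x y) \<in> mpow j"
    then have j: "\<And>x y. x < n \<Longrightarrow> y < n \<Longrightarrow> entry M x y \<in> mpow j" by auto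
    have key: "(if y = l then entry M x k else 0) - (if x = k then entry M l y else 0) \<in> mpow (Suc j)"
      if kl: "k < n" "l < n" "k \<noteq> l" "k \<notin> B" "l \<notin> A" and xy: "x < n" "y < n" for k l x y
    proof -
      have "\<pi> (entry (X k l 1) a b) = (if a = k \<and> b = l then 1 else 0)" if "a < n" "b < n" for a b
        using that kl by (simp add: \<pi>_entry_X \<pi>R_one)
      note * = entry_mult_near_unit[OF M X_in[OF kl(1-3)] kl(1,2) this j xy]
      from mpow_diff[OF *(2) *(1)] show ?thesis by (simp add: comm[OF kl])
    qed
    have offdiag: "entry M x y \<in> mpow (Suc j)" if xy: "x < n" "y < n" "x \<noteq> y" for x y
    proof -
      \<comment> \<open>Outside A x B the bracket isolates the entry (x, y): with k = y, l = q if y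
        is not in B, and with k = p, l = x if x is not in A.\<close>
      consider "x \<in> A" "y \<in> B" | "y \<notin> B" | "x \<notin> A" by blast
      then show ?thesis
      proof cases
        case 1
        then show ?thesis using zero(1) mpow_zero by simp
      next
        case 2
        then have "y \<noteq> q" "q < n" "q \<notin> A" using AB by auto
        then show ?thesis using key[of y q x q] 2 xy by auto
      next
        case 3
        then have "x \<noteq> p" "p < n" "p \<notin> B" using AB by auto
        then show ?thesis using key[of p x p y] 3 xy mpow_uminus[of "- entry M x y"] by auto
      qed
    qed
    have diag: "entry M k k - entry M l l \<in> mpow (Suc j)"
      if "k < n" "l < n" "k \<noteq> l" "k \<notin> B" "l \<notin> A" for k l
      using key[OF that that(1,2)] by simp
    have "entry M x x \<in> mpow (Suc j)" if x: "x < n" for x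
    proof -
      have pq: "p < n" "q < n" "p \<noteq> q" "p \<notin> B" "q \<notin> A" using AB by auto
      \<comment> \<open>A diagonal entry outside A is compared with the vanishing one at p. One
        inside A is then compared with the one at q, which lies outside A.\<close>
      have notA: "entry M y y \<in> mpow (Suc j)" if y: "y < n" "y \<notin> A" for y
        using mpow_uminus[OF diag[of p y]] that pq zero(2) AB(4) by auto
      show ?thesis
      proof (cases "x \<in> A")
        case True
        then have "x \<noteq> q" "x \<notin> B" using AB by auto
        then show ?thesis using mpow_add[OF diag[of x q] notA[of q]] x pq by simp
      qed (use notA x in blast)
    qed
    with offdiag show "\<forall>z\<in>{..<n} \<times> {..<n}. (case z of (x, y) \<Rightarrow> entry M x y) \<in> mpow (Suc j)" by force
  qed (use \<open>x < n\<close> \<open>y < n\<close> in auto)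
  then show "entry M x y = entry 0 x y" by (simp add: entry_simps)
qed

text \<open>E and the X_ab themselves commute with these X_kl. Subtracting from M a combination with
  the same entries on A x B and at one diagonal place (p, p) leaves a matrix that vanishes by
  \<open>commutant_zero\<close>.\<close>

lemma commutant:
  assumes AB: "A \<subseteq> {..<n}" "B \<subseteq> {..<n}" "A \<inter> B = {}" "A \<noteq> {}" "B \<noteq> {}"
    and M: "M \<in> mat_ops n"
    and comm: "\<And>k l. k < n \<Longrightarrow> l < n \<Longrightarrow> k \<noteq> l \<Longrightarrow> k \<notin> B \<Longrightarrow> l \<notin> A \<Longrightarrow> M * X k l 1 = X k l 1 * M"
  shows "\<exists>c d. M = scal c * E + (\<Sum>(a, b)\<in>A \<times> B. scal (d (a, b)) * X a b 1)"
proof -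
  obtain p q where pq: "p \<in> A" "q \<in> B" using AB by blast
  then have pB: "p \<notin> B" "p < n" using AB by auto
  \<comment> \<open>G indexes both the spanning elements and the entries to be matched, with (p, p)
    standing for E. The resulting square system is residually the identity.\<close>
  define G where "G = insert (p, p) (A \<times> B)"
  define Y where "Y f = (if f = (p, p) then E else X (fst f) (snd f) 1)" for f
  have finAB: "finite (A \<times> B)" using AB(1,2) finite_subset by blast
  have G: "fst f < n" "snd f < n" "f \<noteq> (p, p) \<Longrightarrow> fst f \<noteq> snd f" if "f \<in> G" for f
    using that AB pB by (auto simp: G_def)
  have "\<pi> (entry (Y f) (fst g) (snd g)) = (if f = g then 1 else 0)" if "f \<in> G" "g \<in> G" for f g
    using G[OF that(1)] G[OF that(2)] that pB
    by (cases f; cases g) (auto simp: Y_def entry_E \<pi>_entry_X \<pi>R_one G_def)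
  then have "\<exists>d. \<forall>g\<in>G. entry M (fst g) (snd g) = (\<Sum>f\<in>G. d f * entry (Y f) (fst g) (snd g))"
    using finAB by (intro solve_near_identity) (simp_all add: G_def)
  then obtain d where d: "\<And>g. g \<in> G \<Longrightarrow> entry M (fst g) (snd g) = (\<Sum>f\<in>G. d f * entry (Y f) (fst g) (snd g))"
    by blast
  define N where "N = (\<Sum>f\<in>G. scal (d f) * Y f)"
  have Y_in: "Y f \<in> mat_ops n" if "f \<in> G" for f
    using G[OF that] by (auto simp: Y_def E_in X_in)
  then have N_in: "N \<in> mat_ops n" unfolding N_def by (intro mat_ops_sum mat_ops_scal)
  have "M - N = 0"
  proof (rule commutant_zero[OF AB(1-3) pq mat_ops_closed(2)[OF M N_in]])
    have entry0: "entry (M - N) (fst g) (snd g) = 0" if "g \<in> G" for g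
      using d[OF that] by (simp add: N_def entry_simps entry_sum)
    show "entry (M - N) p p = 0" using entry0[of "(p, p)"] by (simp add: G_def)
    show "entry (M - N) a b = 0" if "a \<in> A" "b \<in> B" for a b using entry0[of "(a, b)"] that by (simp add: G_def)
    fix k l assume kl: "k < n" "l < n" "k \<noteq> l" "k \<notin> B" "l \<notin> A"
    have "scal (d f) * Y f * X k l 1 = X k l 1 * (scal (d f) * Y f)" if "f \<in> G" for f
    proof -
      have "Y f * X k l 1 = X k l 1 * Y f"
        using that kl AB by (auto simp: Y_def G_def E_mult X_in intro!: X_commute)
      then show ?thesis using scal_commute[OF X_in[OF kl(1-3)], of 1 "d f"]
        by (simp add: mult.assoc) (metis mult.assoc)
    qed
    then have "N * X k l 1 = X k l 1 * N" by (simp add: N_def sum_distrib_left sum_distrib_right)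
    then show "(M - N) * X k l 1 = X k l 1 * (M - N)"
      using comm[OF kl] by (simp add: algebra_simps)
  qed
  moreover have "N = scal (d (p, p)) * E + (\<Sum>f\<in>A \<times> B. scal (d f) * Y f)"
    using finAB pB by (simp add: N_def G_def Y_def)
  moreover have "(\<Sum>f\<in>A \<times> B. scal (d f) * Y f) = (\<Sum>(a, b)\<in>A \<times> B. scal (d (a, b)) * X a b 1)"
    using pB by (intro sum.cong) (auto simp: Y_def)
  ultimately show ?thesis by (metis (no_types, lifting) right_minus_eq)
qed

text \<open>Independence of the residual matrix units is lifted: if the coefficients lie in m^j, the
  entries at (i, i), (i, j) and (k, l) show that they lie in m^(j+1).\<close>

lemma independent:
  assumes eq: "scal a * E + scal b * X i j 1 + scal c * X k l 1 = 0"
    and ij: "i < n" "j < n" "i \<noteq> j" "k < n" "l < n" "k \<noteq> l" "(i, j) \<noteq> (k, l)"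
  shows "a = 0" "b = 0" "c = 0"
proof -
  have e: "a * entry E x y + b * entry (X i j 1) x y + c * entry (X k l 1) x y = 0" for x y
    using arg_cong[OF eq, of "\<lambda>F. entry F x y"] by (simp add: entry_simps)
  have p: "\<pi> (entry (X i' j' 1) x y - (if x = i' \<and> y = j' then 1 else 0)) = 0"
    if "i' < n" "j' < n" "i' \<noteq> j'" "x < n" "y < n" for i' j' x y
    using that by (simp add: hom_minus \<pi>_entry_X \<pi>R_one)
  have "\<forall>x\<in>{a, b, c}. id x = 0"
  proof
    fix x assume x: "x \<in> {a, b, c}"
    show "id x = 0"
    proof (rule separated_induct[OF _ x])
      fix m assume "\<forall>x\<in>{a, b, c}. id x \<in> mpow m"
      then have m: "a \<in> mpow m" "b \<in> mpow m" "c \<in> mpow m" by auto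
      have *: "a * (if x = y then 1 else 0) + b * (if x = i \<and> y = j then 1 else 0)
          + c * (if x = k \<and> y = l then 1 else 0) \<in> mpow (Suc m)" if xy: "x < n" "y < n" for x y
      proof -
        have "b * (entry (X i j 1) x y - (if x = i \<and> y = j then 1 else 0))
            + c * (entry (X k l 1) x y - (if x = k \<and> y = l then 1 else 0)) \<in> mpow (Suc m)"
          using m p[OF ij(1-3) xy] p[OF ij(4-6) xy] by (intro mpow_add mpow_Suc(2))
        also have "b * (entry (X i j 1) x y - (if x = i \<and> y = j then 1 else 0))
            + c * (entry (X k l 1) x y - (if x = k \<and> y = l then 1 else 0))
            = - (a * (if x = y then 1 else 0) + b * (if x = i \<and> y = j then 1 else 0)
            + c * (if x = k \<and> y = l then 1 else 0))"
          using e[of x y] xy by (simp add: entry_E algebra_simps eq_neg_iff_add_eq_0)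
        finally show ?thesis by (metis mpow_uminus minus_minus)
      qed
      show "\<forall>x\<in>{a, b, c}. id x \<in> mpow (Suc m)"
        using *[of i i] *[of i j] *[of k l] ij by (auto split: if_splits)
    qed
  qed
  then show "a = 0" "b = 0" "c = 0" by auto
qed

end

section \<open>Products of root elements\<close>

lemma mult_commute_mult:
  fixes x :: "'a::ring_1"
  assumes "x * h = h * x" "y * h = h * y"
  shows "x * y * h = h * (x * y)"
proof -
  have "x * y * h = x * h * y" by (simp add: mult.assoc assms(2))
  then show ?thesis by (simp add: assms(1) mult.assoc)
qed

context SL_rep
begin

lemma scal_mult_commute:
  assumes "F \<in> mat_ops n" "G \<in> mat_ops n" "F * G = G * F"
  shows "scal c * F * G = G * (scal c * F)"
  using mult_commute_mult[of "scal c" G F] scal_commute[OF assms(2)] assms(3) by simp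

lemma X_lincomb:
  assumes "i < n" "j < n" "i \<noteq> j"
  shows "\<exists>a b. X i j r = scal a * E + scal b * X i j 1"
  using commutant[of "{i}" "{j}" "X i j r"] assms by (auto simp: X_in X_commute)

text \<open>For a fresh l, X_ij(r) X_il is a combination of E, X_ij and X_il. Bracketing with
  X_lk(q) kills the first two terms and turns X_il into X_ik(q) up to a unit. The scalar is fixed
  before q, hence uniform in q.\<close>

lemma row_product_multiple:
  assumes ij: "i < n" "j < n" "k < n" "i \<noteq> j" "j \<noteq> k" "i \<noteq> k"
  shows "\<exists>\<gamma>. \<forall>q. X i j r * X i k q = scal \<gamma> * X i k q"
proof -
  obtain l where l: "l < n" "l \<noteq> i" "l \<noteq> j" "l \<noteq> k" using fresh_index[of "[i, j, k]"] by auto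
  have "\<exists>c d. X i j r * X i l 1 = scal c * E + (\<Sum>(a, b)\<in>{i} \<times> {j, l}. scal (d (a, b)) * X a b 1)"
  proof (rule commutant)
    fix p q assume pq: "p < n" "q < n" "p \<noteq> q" "p \<notin> {j, l}" "q \<notin> {i}"
    then have "X i l 1 * X p q 1 = X p q 1 * X i l 1" "X i j r * X p q 1 = X p q 1 * X i j r"
      using ij l by (auto intro: X_commute)
    then show "X i j r * X i l 1 * X p q 1 = X p q 1 * (X i j r * X i l 1)" by (intro mult_commute_mult)
  qed (use ij l in \<open>auto simp: X_in mat_ops_closed\<close>)
  then obtain \<alpha> \<beta> \<gamma> where W: "X i j r * X i l 1 = (scal \<alpha> * E + scal \<beta> * X i j 1) + scal \<gamma> * X i l 1"
    using l by (auto simp: insert_Times_insert add.assoc)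
  have "X i j r * X i k q = scal \<gamma> * X i k q" for q
  proof (rule commutator_cancel[OF _ _ _ W])
    let ?H = "X l k q"
    have H: "?H \<in> mat_ops n" using ij l by (simp add: X_in)
    show "X i j r * ?H = ?H * X i j r" using ij l by (auto intro: X_commute)
    show "scal \<gamma> * ?H = ?H * scal \<gamma>" by (simp add: scal_commute[OF H])
    have "X i j 1 * ?H = ?H * X i j 1" using ij l by (auto intro: X_commute)
    then show "(scal \<alpha> * E + scal \<beta> * X i j 1) * ?H = ?H * (scal \<alpha> * E + scal \<beta> * X i j 1)"
      using ij H by (simp add: distrib_left distrib_right scal_mult_commute E_in X_in E_mult)
    \<comment> \<open>The relation is so far only multiplicative, so the bracket equals X_ik(q)
      times a unit on the right, which \<open>commutator_cancel\<close> removes.\<close>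
    show "X i l 1 * ?H - ?H * X i l 1 = X i k q * ((1 + ?H) * (1 + X i l 1))"
      using X_commutator[of i l k 1 q] ij l by (simp add: algebra_simps)
    have "(1 + ?H) * (1 + X i l 1) * ((1 + X i l (-1)) * (1 + X l k (- q)))
      = (1 + ?H) * ((1 + X i l 1) * (1 + X i l (-1))) * (1 + X l k (- q))" by (simp only: mult.assoc)
    then show "(1 + ?H) * (1 + X i l 1) * ((1 + X i l (-1)) * (1 + X l k (- q))) = 1"
      using ij l by (simp add: X_inverse)
  qed
  then show ?thesis by blast
qed

text \<open>Exchanging j and k makes X_ij(r) X_ik a multiple of X_ik and of X_ij(r) alike. By
  independence the scalar is 0 for q = 1, and by uniformity this settles every q.\<close>

lemma row_product_zero:
  assumes ij: "i < n" "j < n" "k < n" "i \<noteq> j" "j \<noteq> k" "i \<noteq> k"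
  shows "X i j r * X i k q = 0"
proof -
  obtain \<gamma> where \<gamma>: "\<And>q. X i j r * X i k q = scal \<gamma> * X i k q" using row_product_multiple[OF ij] by blast
  obtain \<delta> where \<delta>: "\<And>r. X i k 1 * X i j r = scal \<delta> * X i j r"
    using row_product_multiple[of i k j] ij by metis
  obtain a b where ab: "X i j r = scal a * E + scal b * X i j 1" using X_lincomb ij by blast
  have "scal \<gamma> * X i k 1 = scal \<delta> * X i j r"
    using \<gamma>[of 1] \<delta>[of r] X_commute[of i j i k r 1] ij by simp
  then have "scal (\<delta> * a) * E + scal (\<delta> * b) * X i j 1 + scal (- \<gamma>) * X i k 1 = 0"
    unfolding ab by (simp add: scal_simps algebra_simps)
  then have "- \<gamma> = 0" using independent(3) ij by blast
  then show ?thesis using \<gamma> by (simp add: scal_simps)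
qed

text \<open>X_ij(r) commutes with X_kj(q) and kills X_ik, so it also kills the bracket of these two,
  which is X_ij(q) up to a unit.\<close>

lemma square_zero:
  assumes ij: "i < n" "j < n" "i \<noteq> j"
  shows "X i j r * X i j q = 0"
proof -
  obtain k where k: "k < n" "k \<noteq> i" "k \<noteq> j" using fresh_index[of "[i, j]"] by auto
  have "X i j r * X i j q = 0 * X i j q"
  proof (rule commutator_cancel)
    show "X i j r * X i k 1 = 0 + 0 * X i k 1" using row_product_zero ij k by simp
    show "X i j r * X k j q = X k j q * X i j r" using ij k by (auto intro: X_commute)
    show "X i k 1 * X k j q - X k j q * X i k 1 = X i j q * ((1 + X k j q) * (1 + X i k 1))"
      using X_commutator[of i k j 1 q] ij k by (simp add: algebra_simps)
    have "(1 + X k j q) * (1 + X i k 1) * ((1 + X i k (-1)) * (1 + X k j (- q)))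
      = (1 + X k j q) * ((1 + X i k 1) * (1 + X i k (-1))) * (1 + X k j (- q))" by (simp only: mult.assoc)
    then show "(1 + X k j q) * (1 + X i k 1) * ((1 + X i k (-1)) * (1 + X k j (- q))) = 1"
      using ij k by (simp add: X_inverse)
  qed simp_all
  then show ?thesis by simp
qed

text \<open>The transpose of \<open>row_product_multiple\<close>, with the bracket taken against
  X_kl(q).\<close>

lemma column_product_multiple:
  assumes ij: "i < n" "j < n" "k < n" "i \<noteq> j" "j \<noteq> k" "i \<noteq> k"
  shows "\<exists>\<gamma>. \<forall>q. X j i r * X k i q = scal \<gamma> * X k i q"
proof -
  obtain l where l: "l < n" "l \<noteq> i" "l \<noteq> j" "l \<noteq> k" using fresh_index[of "[i, j, k]"] by auto
  have "\<exists>c d. X j i r * X l i 1 = scal c * E + (\<Sum>(a, b)\<in>{j, l} \<times> {i}. scal (d (a, b)) * X a b 1)"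
  proof (rule commutant)
    fix p q assume pq: "p < n" "q < n" "p \<noteq> q" "p \<notin> {i}" "q \<notin> {j, l}"
    then have "X l i 1 * X p q 1 = X p q 1 * X l i 1" "X j i r * X p q 1 = X p q 1 * X j i r"
      using ij l by (auto intro: X_commute)
    then show "X j i r * X l i 1 * X p q 1 = X p q 1 * (X j i r * X l i 1)" by (intro mult_commute_mult)
  qed (use ij l in \<open>auto simp: X_in mat_ops_closed\<close>)
  then obtain \<alpha> \<beta> \<gamma> where W: "X j i r * X l i 1 = (scal \<alpha> * E + scal \<beta> * X j i 1) + scal \<gamma> * X l i 1"
    using l by (auto simp: insert_Times_insert add.assoc)
  have "X j i r * X k i q = scal \<gamma> * X k i q" for q
  proof (rule commutator_cancel[OF _ _ _ W])
    let ?H = "X k l q"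
    have H: "?H \<in> mat_ops n" using ij l by (simp add: X_in)
    show "X j i r * ?H = ?H * X j i r" using ij l by (auto intro: X_commute)
    show "scal \<gamma> * ?H = ?H * scal \<gamma>" by (simp add: scal_commute[OF H])
    have "X j i 1 * ?H = ?H * X j i 1" using ij l by (auto intro: X_commute)
    then show "(scal \<alpha> * E + scal \<beta> * X j i 1) * ?H = ?H * (scal \<alpha> * E + scal \<beta> * X j i 1)"
      using ij H by (simp add: distrib_left distrib_right scal_mult_commute E_in X_in E_mult)
    \<comment> \<open>Here the commutator relation comes in the opposite order, so the unit carries
      a minus sign.\<close>
    show "X l i 1 * ?H - ?H * X l i 1 = X k i q * (- ((1 + X l i 1) * (1 + ?H)))"
      using X_commutator[of k l i q 1] ij l by (simp add: algebra_simps)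
    have "(1 + X l i 1) * (1 + ?H) * ((1 + X k l (- q)) * (1 + X l i (-1)))
      = (1 + X l i 1) * ((1 + ?H) * (1 + X k l (- q))) * (1 + X l i (-1))" by (simp only: mult.assoc)
    then show "(- ((1 + X l i 1) * (1 + ?H))) * (- ((1 + X k l (- q)) * (1 + X l i (-1)))) = 1"
      using ij l by (simp add: X_inverse)
  qed
  then show ?thesis by blast
qed

lemma column_product_zero:
  assumes ij: "i < n" "j < n" "k < n" "i \<noteq> j" "j \<noteq> k" "i \<noteq> k"
  shows "X j i r * X k i q = 0"
proof -
  obtain \<gamma> where \<gamma>: "\<And>q. X j i r * X k i q = scal \<gamma> * X k i q" using column_product_multiple[OF ij] by blast
  obtain \<delta> where \<delta>: "\<And>r. X k i 1 * X j i r = scal \<delta> * X j i r"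
    using column_product_multiple[of i k j] ij by metis
  obtain a b where ab: "X j i r = scal a * E + scal b * X j i 1" using X_lincomb ij by blast
  have "scal \<gamma> * X k i 1 = scal \<delta> * X j i r"
    using \<gamma>[of 1] \<delta>[of r] X_commute[of j i k i r 1] ij by simp
  then have "scal (\<delta> * a) * E + scal (\<delta> * b) * X j i 1 + scal (- \<gamma>) * X k i 1 = 0"
    unfolding ab by (simp add: scal_simps algebra_simps)
  then have "- \<gamma> = 0" using independent(3) ij by blast
  then show ?thesis using \<gamma> by (simp add: scal_simps)
qed

text \<open>X_ik(rs) annihilates X_jk(s) and X_ij(r) from the left, so expanding the group relation
  leaves only the Lie bracket.\<close>

lemma X_bracket:
  assumes ij: "i < n" "j < n" "k < n" "i \<noteq> j" "j \<noteq> k" "i \<noteq> k"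
  shows "X i j r * X j k s - X j k s * X i j r = X i k (r * s)"
proof -
  have "X i k (r * s) * X j k s = 0" "X i k (r * s) * X i j r = 0"
    using ij by (auto intro: column_product_zero row_product_zero)
  then have "X i k (r * s) * (X j k s * X i j r) = 0" by (simp flip: mult.assoc)
  with \<open>X i k (r * s) * X j k s = 0\<close> \<open>X i k (r * s) * X i j r = 0\<close> show ?thesis
    using X_commutator[OF ij, of r s] by (simp add: algebra_simps)
qed

text \<open>The product W is a combination of E, X_ij, X_il, X_kj and X_kl. Bracketing with X_jl
  removes the coefficients of X_ij and X_kj, and bracketing with X_lj those of X_il and X_kl. The
  scalar that remains vanishes because X_ij W = 0.\<close>

lemma disjoint_product_zero:
  assumes ij: "i < n" "j < n" "k < n" "l < n" and dist: "distinct [i, j, k, l]"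
  shows "X i j 1 * X k l 1 = 0"
proof -
  let ?W = "X i j 1 * X k l 1"
  have d: "i \<noteq> j" "i \<noteq> k" "i \<noteq> l" "j \<noteq> k" "j \<noteq> l" "k \<noteq> l" using dist by auto
  have "\<exists>c d. ?W = scal c * E + (\<Sum>(a, b)\<in>{i, k} \<times> {j, l}. scal (d (a, b)) * X a b 1)"
  proof (rule commutant)
    fix p q assume pq: "p < n" "q < n" "p \<noteq> q" "p \<notin> {j, l}" "q \<notin> {i, k}"
    then have "X k l 1 * X p q 1 = X p q 1 * X k l 1" "X i j 1 * X p q 1 = X p q 1 * X i j 1"
      using ij d by (auto intro: X_commute)
    then show "?W * X p q 1 = X p q 1 * ?W" by (intro mult_commute_mult)
  qed (use ij d in \<open>auto simp: X_in mat_ops_closed\<close>)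
  then obtain a c where "?W = scal a * E + (\<Sum>(p, q)\<in>{i, k} \<times> {j, l}. scal (c (p, q)) * X p q 1)" by blast
  moreover have "{i, k} \<times> {j, l} = {(i, j), (i, l), (k, j), (k, l)}" by auto
  ultimately have "?W = scal a * E + scal (c (i, j)) * X i j 1 + scal (c (i, l)) * X i l 1
      + scal (c (k, j)) * X k j 1 + scal (c (k, l)) * X k l 1"
    using d by (simp add: add.assoc)
  then obtain b1 b2 b3 b4 where W: "?W = scal a * E + scal b1 * X i j 1 + scal b2 * X i l 1
      + scal b3 * X k j 1 + scal b4 * X k l 1" by blast
  have br: "?W * H - H * ?W = scal b1 * (X i j 1 * H - H * X i j 1) + scal b2 * (X i l 1 * H - H * X i l 1)
      + scal b3 * (X k j 1 * H - H * X k j 1) + scal b4 * (X k l 1 * H - H * X k l 1)" if H: "H \<in> mat_ops n" for H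
  proof -
    have "H * (scal c * F) = scal c * (H * F)" for c F by (simp add: scal_commute[OF H] flip: mult.assoc)
    then show ?thesis unfolding W using H by (simp add: algebra_simps E_mult)
  qed
  \<comment> \<open>The Leibniz rule for the bracket with H.\<close>
  have split: "?W * H - H * ?W = (X i j 1 * H - H * X i j 1) * X k l 1 + X i j 1 * (X k l 1 * H - H * X k l 1)" for H
    by (simp add: algebra_simps)
  have "?W * X j l 1 - X j l 1 * ?W = 0"
    unfolding split using ij d X_bracket[of i j l 1 1] X_commute[of k l j l 1 1] by (simp add: column_product_zero)
  then have "scal 0 * E + scal b1 * X i l 1 + scal b3 * X k l 1 = 0"
    using br[of "X j l 1"] ij d X_bracket[of i j l 1 1] X_bracket[of k j l 1 1] X_commute[of k l j l 1 1]
      X_commute[of i l j l 1 1] by (simp add: X_in scal_simps)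
  from independent(2,3)[OF this] have b13: "b1 = 0" "b3 = 0" using ij d by auto
  have "?W * X l j 1 - X l j 1 * ?W = 0"
    unfolding split using ij d X_bracket[of k l j 1 1] X_commute[of i j l j 1 1] by (simp add: column_product_zero)
  then have "scal 0 * E + scal b2 * X i j 1 + scal b4 * X k j 1 = 0"
    using br[of "X l j 1"] ij d X_bracket[of i l j 1 1] X_bracket[of k l j 1 1] X_commute[of k j l j 1 1]
      X_commute[of i j l j 1 1] by (simp add: X_in scal_simps)
  from independent(2,3)[OF this] have b24: "b2 = 0" "b4 = 0" using ij d by auto
  have Wa: "?W = scal a * E" unfolding W by (simp add: b13 b24 scal_simps)
  have "X i j 1 * ?W = 0" using ij d by (simp add: square_zero flip: mult.assoc)
  then have "scal a * X i j 1 = 0" unfolding Wa using ij d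
    by (metis E_mult(2) X_in mult.assoc scal_commute)
  then have "scal 0 * E + scal a * X i j 1 + scal 0 * X i k 1 = 0" by (simp add: scal_simps)
  from independent(2)[OF this] have "a = 0" using ij d by auto
  then show ?thesis using Wa by (simp add: scal_simps)
qed

text \<open>By the Leibniz rule the bracket of X_jk X_ij with X_pq can be nonzero only for p = j or
  q = j. There it becomes a product X_jk X_iq or X_pk X_ij, already known to vanish, so the
  commutant for A = {i}, B = {k} applies.\<close>

lemma reverse_product_lincomb:
  assumes ij: "i < n" "j < n" "k < n" "i \<noteq> j" "j \<noteq> k" "i \<noteq> k"
  shows "\<exists>a b. X j k 1 * X i j 1 = scal a * E + scal b * X i k 1"
proof -
  let ?Q = "X j k 1 * X i j 1"
  have "\<exists>c d. ?Q = scal c * E + (\<Sum>(a, b)\<in>{i} \<times> {k}. scal (d (a, b)) * X a b 1)"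
  proof (rule commutant)
    fix p q assume pq: "p < n" "q < n" "p \<noteq> q" "p \<notin> {k}" "q \<notin> {i}"
    have split: "?Q * H - H * ?Q = (X j k 1 * H - H * X j k 1) * X i j 1 + X j k 1 * (X i j 1 * H - H * X i j 1)" for H
      by (simp add: algebra_simps)
    have "?Q * X p q 1 - X p q 1 * ?Q = 0"
    proof -
      consider "p \<noteq> j" "q \<noteq> j" | "p = j" | "q = j" by blast
      then show ?thesis
      proof cases
        case 1
        then show ?thesis unfolding split
          using pq ij X_commute[of j k p q 1 1] X_commute[of i j p q 1 1] by simp
      next
        case 2
        have "X j k 1 * X i q 1 = 0"
          using ij pq 2 disjoint_product_zero[of j k i q] column_product_zero[of k j i 1 1] by (cases "q = k") auto
        then show ?thesis unfolding split
          using pq ij 2 X_commute[of j k p q 1 1] X_bracket[of i j q 1 1] by simp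
      next
        case 3
        have br: "X j k 1 * X p j 1 - X p j 1 * X j k 1 = - X p k 1"
          using X_bracket[of p j k 1 1] pq ij 3 by (simp add: algebra_simps)
        have "X p k 1 * X i j 1 = 0"
          using ij pq 3 disjoint_product_zero[of p k i j] row_product_zero[of p k j 1 1] by (cases "p = i") auto
        then show ?thesis unfolding split
          using pq ij 3 X_commute[of i j p q 1 1] by (simp add: br)
      qed
    qed
    then show "?Q * X p q 1 = X p q 1 * ?Q" by simp
  qed (use ij in \<open>auto simp: X_in mat_ops_closed\<close>)
  then show ?thesis by auto
qed

text \<open>Multiplying a + b X_ik from the left by X_li for a fresh l gives 0, since X_li X_jk = 0.
  As X_li X_ik = X_lk + X_ik X_li with X_ik X_li = a' + b' X_lk, independence yields a = 0 and b (1
  + b') = 0.\<close>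

lemma reverse_product_zero:
  assumes ij: "i < n" "j < n" "k < n" "i \<noteq> j" "j \<noteq> k" "i \<noteq> k"
  shows "X j k 1 * X i j 1 = 0"
proof -
  obtain l where l: "l < n" "l \<noteq> i" "l \<noteq> j" "l \<noteq> k" using fresh_index[of "[i, j, k]"] by auto
  obtain a b where ab: "X j k 1 * X i j 1 = scal a * E + scal b * X i k 1"
    using reverse_product_lincomb ij by blast
  obtain a' b' where ab': "X i k 1 * X l i 1 = scal a' * E + scal b' * X l k 1"
    using reverse_product_lincomb[of l i k] ij l by auto
  \<comment> \<open>Modulo m the product is E_ik E_li = 0, so b' lies in m and 1 + b' is a
    unit.\<close>
  have "\<pi> (entry (X i k 1 * X l i 1) l k) = 0"
    using ij l by (simp add: entry_mult[of _ n] X_in hom_sum hom_mult \<pi>_entry_X)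
  then have "\<pi> b' = 0"
    using ij l by (simp add: ab' entry_simps entry_E hom_mult \<pi>_entry_X \<pi>R_one)
  then have "\<pi> (1 + b') \<noteq> 0" by (simp add: hom_add)
  then obtain w where w: "(1 + b') * w = 1" using unit_iff by blast
  have com: "X l i 1 * scal c = scal c * X l i 1" for c
    by (rule scal_commute[OF X_in]) (use ij l in auto)
  have "X l i 1 * (X j k 1 * X i j 1) = 0"
    using disjoint_product_zero[of l i j k] ij l by (simp flip: mult.assoc)
  then have "scal a * X l i 1 + scal b * (X l i 1 * X i k 1) = 0"
    unfolding ab using ij l by (simp add: distrib_left com E_mult X_in flip: mult.assoc) (simp add: mult.assoc E_mult X_in)
  moreover have "X l i 1 * X i k 1 = X l k 1 + (scal a' * E + scal b' * X l k 1)"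
    using X_bracket[of l i k 1 1] ij l by (simp add: algebra_simps flip: ab')
  ultimately have "scal (b * a') * E + scal a * X l i 1 + scal (b * (1 + b')) * X l k 1 = 0"
    by (simp add: scal_simps distrib_left distrib_right mult.assoc add.commute add.left_commute)
  from independent(2,3)[OF this] have "a = 0" "b * (1 + b') = 0" using ij l by auto
  moreover from this have "b = 0" using w by (metis mult.assoc mult.right_neutral mult_zero_left)
  ultimately show ?thesis by (simp add: ab scal_simps)
qed

lemma X_chain:
  assumes ij: "i < n" "j < n" "k < n" "i \<noteq> j" "j \<noteq> k" "i \<noteq> k"
  shows "X i j 1 * X j k 1 = X i k 1"
  using X_bracket[OF ij, of 1 1] reverse_product_zero[OF ij] by simp

text \<open>Together with \<open>X_chain\<close> this covers every product of two root elements
  except X_ij X_ji.\<close>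

lemma X_product_zero:
  assumes "i < n" "j < n" "k < n" "l < n" "i \<noteq> j" "k \<noteq> l" "j \<noteq> k"
  shows "X i j 1 * X k l 1 = 0"
  using assms square_zero[of i j 1 1] row_product_zero[of i j l 1 1] column_product_zero[of j i k 1 1]
    reverse_product_zero[of k i j] disjoint_product_zero[of i j k l] by auto

section \<open>The scalars f(r) with X_ij(r) = f(r) X_ij, and the conjugating matrix\<close>

lemma X_scalar:
  assumes ij: "i < n" "j < n" "i \<noteq> j"
  shows "\<exists>b. X i j r = scal b * X i j 1"
proof -
  obtain k where k: "k < n" "k \<noteq> i" "k \<noteq> j" using fresh_index[of "[i, j]"] by auto
  obtain a b where ab: "X i j r = scal a * E + scal b * X i j 1" using X_lincomb ij by blast
  \<comment> \<open>Right multiplication by X_ik kills X_ij(r) and X_ij alike and so isolates the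
    constant term.\<close>
  have "(scal a * E + scal b * X i j 1) * X i k 1 = 0" "X i j 1 * X i k 1 = 0"
    unfolding ab[symmetric] using row_product_zero ij k by auto
  then have "scal a * X i k 1 = 0" using ij k by (simp add: distrib_right mult.assoc E_mult X_in)
  then have "scal 0 * E + scal a * X i k 1 + scal 0 * X i j 1 = 0" by (simp add: scal_simps)
  from independent(2)[OF this] have "a = 0" using ij k by auto
  then show ?thesis using ab by (auto simp: scal_simps)
qed

lemma X_scalar_unique:
  assumes ij: "i < n" "j < n" "i \<noteq> j" and eq: "scal b * X i j 1 = scal c * X i j 1"
  shows "b = c"
proof -
  have "scal 0 * E + scal (b - c) * X i j 1 + scal 0 * X j i 1 = 0"
    using eq by (simp add: scal_simps algebra_simps)
  from independent(2)[OF this] show ?thesis using ij by auto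
qed

text \<open>With r or s equal to 1 this moves a coefficient to another row or column; with both
  arbitrary it gives multiplicativity.\<close>

lemma X_scalar_mult:
  assumes ij: "i < n" "j < n" "k < n" "i \<noteq> j" "j \<noteq> k" "i \<noteq> k"
    and b: "X i j r = scal b * X i j 1" and c: "X j k s = scal c * X j k 1"
  shows "X i k (r * s) = scal (b * c) * X i k 1"
proof -
  have com: "X u v 1 * scal d = scal d * X u v 1" if "u < n" "v < n" "u \<noteq> v" for u v d
    by (rule scal_commute[OF X_in[OF that]])
  have "X i k (r * s) = X i j r * X j k s - X j k s * X i j r" using X_bracket ij by simp
  also have "X i j r * X j k s = scal b * (X i j 1 * scal c) * X j k 1" by (simp add: b c mult.assoc)
  also have "\<dots> = scal (b * c) * (X i j 1 * X j k 1)" using ij by (simp add: com scal_simps mult.assoc)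
  also have "X j k s * X i j r = scal c * (X j k 1 * scal b) * X i j 1" by (simp add: b c mult.assoc)
  also have "\<dots> = scal (c * b) * (X j k 1 * X i j 1)" using ij by (simp add: com scal_simps mult.assoc)
  finally show ?thesis using ij by (simp add: X_chain reverse_product_zero)
qed

text \<open>The homomorphism f, read off at position (0, 1); \<open>X_eq_coeff\<close> shows that
  every other position gives the same scalar.\<close>

definition coeff :: "'r \<Rightarrow> 's" where
  "coeff r = (SOME b. X 0 1 r = scal b * X 0 1 1)"

lemma X_eq_coeff:
  assumes "i < n" "j < n" "i \<noteq> j"
  shows "X i j r = scal (coeff r) * X i j 1"
proof -
  have s1: "X i j 1 = scal 1 * X i j 1" for i j by (simp add: scal_simps)
  have 01: "X 0 1 r = scal (coeff r) * X 0 1 1"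
    unfolding coeff_def by (rule someI_ex[OF X_scalar]) (use n4 in auto)
  have right: "X i k r = scal (coeff r) * X i k 1"
    if "X i j r = scal (coeff r) * X i j 1" "i < n" "j < n" "k < n" "i \<noteq> j" "i \<noteq> k" for i j k
  proof (cases "j = k")
    case False
    from X_scalar_mult[OF that(2-5) this that(6,1) s1] show ?thesis by simp
  qed (use that in simp)
  have left: "X i k r = scal (coeff r) * X i k 1"
    if "X j k r = scal (coeff r) * X j k 1" "i < n" "j < n" "k < n" "j \<noteq> k" "i \<noteq> k" for i j k
  proof (cases "i = j")
    case False
    from X_scalar_mult[OF that(2-4) this that(5,6) s1 that(1)] show ?thesis by simp
  qed (use that in simp)
  have 0: "X 0 k r = scal (coeff r) * X 0 k 1" if "k < n" "k \<noteq> 0" for k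
    by (rule right[OF 01]) (use that n4 in auto)
  \<comment> \<open>From (0, 1) one first changes the column, then the row. Column 0 cannot be
    reached this way, since (0, 0) is no root position; it is entered from (i, k) with a third index
    k.\<close>
  show ?thesis
  proof (cases "j = 0")
    case True
    obtain k where k: "k < n" "k \<noteq> i" "k \<noteq> 0" using fresh_index[of "[i, 0]"] by auto
    have "X i k r = scal (coeff r) * X i k 1" by (rule left[OF 0[of k]]) (use k assms in auto)
    then show ?thesis by (rule right) (use k assms in auto)
  next
    case False
    then show ?thesis by (intro left[OF 0[of j]]) (use assms in auto)
  qed
qed

lemma \<pi>_coeff: "\<pi> (coeff r) = \<pi>R r"
proof -
  have "\<pi> (entry (X 0 1 r) 0 1) = \<pi> (coeff r)"
    using n4 by (subst X_eq_coeff) (auto simp: entry_simps hom_mult \<pi>_entry_X \<pi>R_one)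
  then show ?thesis using n4 by (simp add: \<pi>_entry_X)
qed

lemma is_ring_hom_coeff: "is_ring_hom coeff"
proof -
  have n: "0 < n" "1 < n" "2 < n" using n4 by auto
  have "scal (coeff 1) * X 0 1 1 = scal 1 * X 0 1 1"
    using X_eq_coeff[of 0 1 1, symmetric] n by (simp add: scal_simps)
  then have 1: "coeff 1 = 1" by (rule X_scalar_unique[rotated -1]) (use n in auto)
  \<comment> \<open>The cross term of the product vanishes by \<open>square_zero\<close>.\<close>
  have "X 0 1 (a + b) = X 0 1 a + X 0 1 b" for a b
    using X_add[of 0 1 a b] square_zero[of 0 1 a b] n by (simp add: algebra_simps)
  then have "scal (coeff (a + b)) * X 0 1 1 = scal (coeff a + coeff b) * X 0 1 1" for a b
    using X_eq_coeff[of 0 1 a, symmetric] X_eq_coeff[of 0 1 b, symmetric] X_eq_coeff[of 0 1 "a + b", symmetric] n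
    by (simp add: scal_simps distrib_right)
  then have 2: "coeff (a + b) = coeff a + coeff b" for a b by (rule X_scalar_unique[rotated -1]) (use n in auto)
  have "scal (coeff (a * b)) * X 0 2 1 = scal (coeff a * coeff b) * X 0 2 1" for a b
  proof -
    have "X 0 2 (a * b) = scal (coeff a * coeff b) * X 0 2 1"
      by (rule X_scalar_mult[of 0 1 2, OF _ _ _ _ _ _ X_eq_coeff X_eq_coeff]) (use n in auto)
    then show ?thesis using X_eq_coeff[of 0 2 "a * b", symmetric] n by simp
  qed
  then have 3: "coeff (a * b) = coeff a * coeff b" for a b by (rule X_scalar_unique[rotated -1]) (use n in auto)
  from 1 2 3 show ?thesis by (simp add: is_ring_hom_def)
qed

text \<open>\<open>e i\<close> is the matrix unit \<open>E_i1\<close> in the new basis; the diagonal one has to be written as a product.\<close>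

definition e :: "nat \<Rightarrow> 's seq_op" where
  "e i = (if i = 1 then X 1 0 1 * X 0 1 1 else X i 1 1)"

lemma e_in: "i < n \<Longrightarrow> e i \<in> mat_ops n"
  using n4 by (auto simp: e_def X_in mat_ops_closed)

text \<open>The rule E_ij E_l1 = \<delta>_jl E_i1. Since \<open>X_chain\<close> needs three distinct
  indices, products passing through a diagonal unit are rewritten by way of another index.\<close>

lemma X_mult_e:
  assumes "i < n" "j < n" "i \<noteq> j" "l < n"
  shows "X i j 1 * e l = (if j = l then e i else 0)"
proof -
  have n: "0 < n" "Suc 0 < n" "2 < n" using n4 by auto
  consider "l \<noteq> 1" "j \<noteq> l" | "l \<noteq> 1" "j = l" "i \<noteq> 1" | "l \<noteq> 1" "j = l" "i = 1" "l = 0"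
    | "l \<noteq> 1" "j = l" "i = 1" "l \<noteq> 0" | "l = 1" "j \<noteq> 1" | "l = 1" "j = 1" "i \<noteq> 0" | "l = 1" "j = 1" "i = 0"
    by blast
  then show ?thesis
  proof cases
    \<comment> \<open>X_l1 is factored through 0, so that X_1l X_l1 becomes the chosen diagonal
      element X_10 X_01.\<close>
    case 4
    have "X i j 1 * e l = X 1 l 1 * X l 1 1" using 4 by (simp add: e_def)
    also have "X l 1 1 = X l 0 1 * X 0 1 1" using X_chain[of l 0 1] 4 n assms by simp
    also have "X 1 l 1 * (X l 0 1 * X 0 1 1) = X 1 0 1 * X 0 1 1"
      using X_chain[of 1 l 0] 4 n assms by (simp flip: mult.assoc)
    finally show ?thesis using 4 by (simp add: e_def)
  next
    case 6
    have "X i j 1 * e l = (X i 1 1 * X 1 0 1) * X 0 1 1" using 6 by (simp add: e_def mult.assoc)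
    also have "\<dots> = e i" using X_chain[of i 1 0] X_chain[of i 0 1] 6 n assms by (simp add: e_def)
    finally show ?thesis using 6 by simp
  next
    \<comment> \<open>A detour through the index 2 keeps the end indices of each contraction
      distinct.\<close>
    case 7
    have "X i j 1 * e l = X 0 1 1 * (X 1 0 1 * X 0 1 1)" using 7 by (simp add: e_def)
    also have "\<dots> = (X 0 2 1 * X 2 1 1) * (X 1 0 1 * X 0 1 1)" using n X_chain[of 0 2 1] by simp
    also have "\<dots> = X 0 2 1 * ((X 2 1 1 * X 1 0 1) * X 0 1 1)" by (simp only: mult.assoc)
    also have "\<dots> = e i" using X_chain[of 2 1 0] X_chain[of 2 0 1] X_chain[of 0 2 1] 7 n by (simp add: e_def)
    finally show ?thesis using 7 by simp
  next
    case 5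
    have "X i j 1 * e l = (X i j 1 * X 1 0 1) * X 0 1 1" using 5 by (simp add: e_def mult.assoc)
    then show ?thesis using X_product_zero[of i j 1 0] 5 n assms by simp
  next
    case 1
    then show ?thesis using X_product_zero[of i j l 1] n assms by (simp add: e_def)
  next
    case 2
    then show ?thesis using X_chain[of i j 1] n assms by (simp add: e_def)
  next
    case 3
    then show ?thesis by (simp add: e_def)
  qed
qed

text \<open>Column i is column 1 of \<open>e i\<close>, residually the i-th unit vector. By
  \<open>X_mult_e\<close>, X_ij permutes these columns as E_ij does, that is, X_ij K = K
  E_ij.\<close>

definition K :: "'s mat" where
  "K = mat n n (\<lambda>(x, i). entry (e i) x 1)"

lemma K_carrier: "K \<in> carrier_mat n n"
  by (simp add: K_def)

lemma \<pi>_K: "map_mat \<pi> K = 1\<^sub>m n"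
proof (rule eq_matI)
  fix x i assume "x < dim_row (1\<^sub>m n :: 'k mat)" "i < dim_col (1\<^sub>m n :: 'k mat)"
  then have x: "x < n" "i < n" by auto
  have n: "0 < n" "Suc 0 < n" using n4 by auto
  have "\<pi> (entry (X 1 0 1 * X 0 1 1) x 1) = (if x = 1 then 1 else 0)"
    using n x by (simp add: entry_mult[of _ n] X_in hom_sum hom_mult \<pi>_entry_X \<pi>R_one if_distrib cong: if_cong)
  then show "map_mat \<pi> K $$ (x, i) = (1\<^sub>m n) $$ (x, i)"
    using n x \<pi>_entry_X[of i 1 x 1 1] by (cases "i = 1"; cases "x = i") (auto simp: K_def e_def \<pi>R_one)
qed (simp_all add: K_def)

lemma intertwine_elementary:
  assumes ij: "i < n" "j < n" "i \<noteq> j"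
  shows "\<rho> (addrow_mat n r i j) * K = K * map_mat coeff (addrow_mat n r i j)"
proof (rule eq_matI)
  interpret f: comm_ring_hom coeff by (rule is_ring_hom_comm_ring_hom[OF is_ring_hom_coeff])
  let ?t = "addrow_mat n r i j"
  have t: "\<rho> ?t \<in> carrier_mat n n" using ij by (simp add: \<rho>_carrier addrow_mat_in_SL)
  fix x l assume "x < dim_row (K * map_mat coeff ?t)" "l < dim_col (K * map_mat coeff ?t)"
  then have x: "x < n" "l < n" by (auto simp: K_def)
  have n: "Suc 0 < n" using n4 by auto
  have "(\<rho> ?t * K) $$ (x, l) = (\<Sum>k<n. \<rho> ?t $$ (x, k) * K $$ (k, l))"
    by (rule index_mult_mat_sum[OF t K_carrier x])
  \<comment> \<open>The image of t_ij(r) is split into its root element and the identity.\<close>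
  also have "\<dots> = (\<Sum>k<n. (entry (X i j r) x k + (if x = k then 1 else 0)) * entry (e l) k 1)"
    using t x by (intro sum.cong) (auto simp: X_def entry_mat_op K_def)
  also have "\<dots> = entry (X i j r * e l) x 1 + entry (e l) x 1"
    using x n ij by (simp add: distrib_right sum.distrib entry_mult[of _ n] X_in e_in
      if_distrib[of "\<lambda>z. z * _"] cong: if_cong)
  also have "X i j r * e l = scal (coeff r) * (if j = l then e i else 0)"
    using ij x by (subst X_eq_coeff) (simp_all add: X_mult_e mult.assoc)
  also have "entry \<dots> x 1 + entry (e l) x 1 = (\<Sum>k<n. K $$ (x, k) * map_mat coeff ?t $$ (k, l))"
  proof -
    have "(\<Sum>k<n. K $$ (x, k) * map_mat coeff ?t $$ (k, l))
      = (\<Sum>k<n. (if k = i then (if j = l then coeff r * entry (e i) x 1 else 0) else 0) + (if k = l then entry (e l) x 1 else 0))"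
      using x ij by (intro sum.cong) (auto simp: K_def f.hom_add algebra_simps)
    then show ?thesis using x ij by (simp add: sum.distrib entry_simps)
  qed
  also have "\<dots> = (K * map_mat coeff ?t) $$ (x, l)"
    by (rule index_mult_mat_sum[symmetric]) (use K_carrier x in auto)
  finally show "(\<rho> ?t * K) $$ (x, l) = (K * map_mat coeff ?t) $$ (x, l)" .
qed (use \<rho>_carrier[OF addrow_mat_in_SL[OF ij]] in \<open>auto simp: K_def\<close>)

end

section \<open>Generation of the special linear group\<close>

context chat_ring
begin

text \<open>Gaussian elimination over a local ring, phrased as induction: column by column, a unit
  on or below the diagonal yields a pivot 1, which clears the rest of its column.\<close>

lemma SL_elementary_induct [consumes 1, case_names one step]:
  fixes A :: "'s mat"
  assumes A: "A \<in> SL n"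
    and one: "P (1\<^sub>m n)"
    and step: "\<And>g i j r. g \<in> SL n \<Longrightarrow> i < n \<Longrightarrow> j < n \<Longrightarrow> i \<noteq> j \<Longrightarrow> P g \<Longrightarrow> P (addrow_mat n r i j * g)"
  shows "P A"
proof -
  \<comment> \<open>The inverse of t_ij(r) is t_ij(-r), so the property can be pulled back along a
    row operation.\<close>
  have cancel_step: "P B" if B: "B \<in> SL n" "P (addrow_mat n r i j * B)" and ij: "i < n" "j < n" "i \<noteq> j" for B i j r
  proof -
    have c: "B \<in> carrier_mat n n" using B by (simp add: SL_def)
    have "P (addrow_mat n (- r) i j * (addrow_mat n r i j * B))"
      using B ij by (intro step[OF SL_mult[OF addrow_mat_in_SL]])
    moreover have "addrow_mat n (- r) i j * (addrow_mat n r i j * B) = B"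
    proof -
      have "addrow_mat n (0::'s) i j = 1\<^sub>m n" by (intro eq_matI) auto
      moreover have "addrow_mat n (- r) i j * (addrow_mat n r i j * B) = addrow_mat n (- r + r) i j * B"
        by (simp only: addrow_mat_mult_same[OF ij] flip: assoc_mult_mat[OF addrow_mat_carrier addrow_mat_carrier c])
      ultimately show ?thesis using c by simp
    qed
    ultimately show ?thesis by simp
  qed
  define std where "std m B \<longleftrightarrow> (\<forall>x<n. \<forall>y<m. B $$ (x, y) = (if x = y then 1 else 0))" for m and B :: "'s mat"
  \<comment> \<open>Row j vanishes in the first m columns because j >= m, so adding it elsewhere
    preserves them.\<close>
  have std_step: "std m (addrow_mat n r i j * B)" if "B \<in> SL n" "std m B" "i < n" "j < n" "m \<le> j" "m \<le> n" for B m i j r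
    using that by (auto simp: std_def SL_def index_addrow_mat_mult[of _ n n] simp del: index_mult_mat(1))
  \<comment> \<open>The number m of finished columns runs downwards from n, where B is the
    identity.\<close>
  have "P B" if "B \<in> SL n" "std m B" "m \<le> n" for B m
    using that(3,1,2)
  proof (induction m arbitrary: B rule: inc_induct)
    case base
    then have "B = 1\<^sub>m n" by (intro eq_matI) (auto simp: std_def SL_def)
    then show ?case using one by simp
  next
    case (step m)
    have from_one: "P B" if "B \<in> SL n" "std m B" "B $$ (m, m) = 1" for B
    proof -
      \<comment> \<open>Rows from h on are already cleared in column m, apart from the pivot.
        Lowering h from n to 0 clears the whole column.\<close>
      have "P B" if "B \<in> SL n" "std m B" "B $$ (m, m) = 1" "h \<le> n" "\<And>x. h \<le> x \<Longrightarrow> x < n \<Longrightarrow> x \<noteq> m \<Longrightarrow> B $$ (x, m) = 0" for B h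
        using that
      proof (induction h arbitrary: B)
        case 0
        then have "std (Suc m) B" by (auto simp: std_def less_Suc_eq)
        then show ?case using step.IH 0 by simp
      next
        case (Suc h)
        show ?case
        proof (cases "h = m")
          case True
          then show ?thesis using Suc.prems by (intro Suc.IH) (auto simp: Suc_le_eq)
        next
          case False
          let ?C = "addrow_mat n (- B $$ (h, m)) h m * B"
          have h: "h < n" "m < n" using Suc.prems(4) step.hyps by auto
          have C: "?C $$ (x, y) = (if h = x then - B $$ (h, m) * B $$ (m, y) + B $$ (x, y) else B $$ (x, y))"
            if "x < n" "y < n" for x y
            using that Suc.prems(1) h by (intro index_addrow_mat_mult) (auto simp: SL_def)
          have "?C \<in> SL n" using Suc.prems(1) h False by (intro SL_mult addrow_mat_in_SL)
          moreover have "std m ?C" using Suc.prems h by (intro std_step) auto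
          moreover have "?C $$ (x, m) = 0" if "h \<le> x" "x < n" "x \<noteq> m" for x
            using that Suc.prems(3) Suc.prems(5)[of x] h by (auto simp: C Suc_le_eq)
          ultimately have "P ?C" using Suc.prems(3) h False by (intro Suc.IH) (auto simp: C)
          then show ?thesis using cancel_step Suc.prems(1) h False by blast
        qed
      qed
      from this[of B n] that show ?thesis by simp
    qed
    have from_unit: "P B" if B: "B \<in> SL n" "std m B" and i: "m < i" "i < n" "\<pi> (B $$ (i, m)) \<noteq> 0" for B i
    proof -
      obtain w where w: "B $$ (i, m) * w = 1" using i unit_iff by blast
      \<comment> \<open>The multiple of row i is chosen so that the diagonal entry becomes exactly
        1.\<close>
      let ?C = "addrow_mat n ((1 - B $$ (m, m)) * w) m i * B"
      have "?C $$ (m, m) = (1 - B $$ (m, m)) * (B $$ (i, m) * w) + B $$ (m, m)"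
        using B i by (subst index_addrow_mat_mult[of _ n n]) (auto simp: SL_def ac_simps)
      then have "?C $$ (m, m) = 1" by (simp add: w)
      moreover have "?C \<in> SL n" using B i by (intro SL_mult addrow_mat_in_SL) auto
      moreover have "std m ?C" using B i by (intro std_step) auto
      ultimately have "P ?C" by (intro from_one)
      then show ?thesis using cancel_step B i by (metis less_trans less_irrefl)
    qed
    have Bc: "B \<in> carrier_mat n n" "det B = 1" using step.prems by (auto simp: SL_def)
    have m: "m < n" using step.hyps by simp
    show ?case
    proof (cases "Suc m = n")
      case True
      \<comment> \<open>No row is left below the last pivot; the determinant condition makes that
        pivot 1.\<close>
      have "upper_triangular B" using step.prems Bc True by (auto simp: std_def)
      then have "(\<Prod>i<n. B $$ (i, i)) = 1"
        using det_upper_triangular[of B n] Bc by (simp add: prod_list_diag_prod lessThan_atLeast0)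
      moreover have "(\<Prod>i<n. B $$ (i, i)) = (\<Prod>i<m. B $$ (i, i)) * B $$ (m, m)"
        unfolding True[symmetric] by simp
      moreover have "(\<Prod>i<m. B $$ (i, i)) = 1" using step.prems m by (intro prod.neutral) (auto simp: std_def)
      ultimately show ?thesis using from_one step.prems by simp
    next
      case False
      have "\<exists>i<n. m \<le> i \<and> \<pi> (B $$ (i, m)) \<noteq> 0"
      proof (rule ccontr)
        assume "\<not> ?thesis"
        then have z: "\<pi> (B $$ (i, m)) = 0" if "m \<le> i" "i < n" for i using that by blast
        \<comment> \<open>If column m were residually zero from row m on, it would be a combination
          of the earlier standard columns; v records this relation and contradicts det B =
          1.\<close>
        define v where "v = vec n (\<lambda>y. if y = m then 1 else if y < m then - \<pi> (B $$ (y, m)) else 0)"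
        have "map_mat \<pi> B *\<^sub>v v = 0\<^sub>v n"
        proof (rule eq_vecI)
          fix x assume "x < dim_vec (0\<^sub>v n :: 'k vec)"
          then have x: "x < n" by simp
          have "(map_mat \<pi> B *\<^sub>v v) $ x = (\<Sum>y<n. \<pi> (B $$ (x, y)) * v $ y)"
            using x Bc by (simp add: scalar_prod_def v_def lessThan_atLeast0)
          also have "\<dots> = (\<Sum>y<n. (if y = m then \<pi> (B $$ (x, m)) else 0)
              + (if y = x then (if x < m then - \<pi> (B $$ (x, m)) else 0) else 0))"
            using x step.prems(2) by (intro sum.cong) (auto simp: v_def std_def)
          also have "\<dots> = 0" using x m z[of x] by (simp add: sum.distrib)
          finally show "(map_mat \<pi> B *\<^sub>v v) $ x = 0\<^sub>v n $ x" using x by simp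
        qed (use Bc in simp)
        moreover have "v \<in> carrier_vec n" by (simp add: v_def)
        moreover have "v \<noteq> 0\<^sub>v n"
        proof
          assume "v = 0\<^sub>v n"
          then have "v $ m = 0" using m by simp
          then show False using m by (simp add: v_def)
        qed
        ultimately have "det (map_mat \<pi> B) = 0"
          using det_0_iff_vec_prod_zero[of "map_mat \<pi> B" n] Bc by auto
        then show False using Bc by simp
      qed
      then obtain i where i: "i < n" "m \<le> i" "\<pi> (B $$ (i, m)) \<noteq> 0" by blast
      show ?thesis
      proof (cases "\<pi> (B $$ (Suc m, m)) \<noteq> 0 \<or> i \<noteq> m")
        case True
        then show ?thesis
        proof
          assume "\<pi> (B $$ (Suc m, m)) \<noteq> 0"
          then show ?thesis using from_unit[of B "Suc m"] step.prems m False by simp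
        next
          assume "i \<noteq> m"
          then show ?thesis using from_unit[of B i] step.prems i by simp
        qed
      next
        case no_unit_below: False
        \<comment> \<open>The unit sits on the diagonal and the entry just below it lies in m;
          adding row m to the next row creates a unit below the diagonal.\<close>
        let ?C = "addrow_mat n 1 (Suc m) m * B"
        have Sm: "Suc m < n" using m False by simp
        have "?C $$ (Suc m, m) = B $$ (m, m) + B $$ (Suc m, m)"
          using Bc Sm by (subst index_addrow_mat_mult[of _ n n]) auto
        then have "\<pi> (?C $$ (Suc m, m)) \<noteq> 0" using no_unit_below i by (simp add: hom_add)
        moreover have "?C \<in> SL n" using step.prems Sm by (intro SL_mult addrow_mat_in_SL) auto
        moreover have "std m ?C" using step.prems Sm by (intro std_step) auto
        ultimately have "P ?C" using from_unit[of ?C "Suc m"] Sm by simp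
        then show ?thesis using cancel_step step.prems Sm by (metis Suc_lessD n_not_Suc_n)
      qed
    qed
  qed
  from this[of A 0] show ?thesis using A by (simp add: std_def)
qed

text \<open>The determinant has residue 1 and is a unit, so the adjugate can be divided by
  it.\<close>

lemma residually_one_invertible:
  assumes K: "K \<in> carrier_mat n n" and "map_mat \<pi> K = 1\<^sub>m n"
  obtains L where "L \<in> carrier_mat n n" "K * L = 1\<^sub>m n" "L * K = 1\<^sub>m n"
proof -
  have "\<pi> (det K) = 1" using assms(2) by (metis hom_det det_one)
  then obtain w where "det K * w = 1" using unit_iff[of "det K"] by auto
  then have w: "det K * w = 1" "w * det K = 1" by (simp_all add: mult.commute)
  show ?thesis
  proof (rule that)
    note adj = adj_mat[OF K]
    show "w \<cdot>\<^sub>m adj_mat K \<in> carrier_mat n n" using adj by simp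
    show "K * (w \<cdot>\<^sub>m adj_mat K) = 1\<^sub>m n"
      using adj K by (simp add: mult_smult_distrib[of _ n n _ n]) (intro eq_matI, auto simp: w)
    show "w \<cdot>\<^sub>m adj_mat K * K = 1\<^sub>m n"
      using adj K by (simp add: mult_smult_assoc_mat[of _ n n _ n]) (intro eq_matI, auto simp: w)
  qed
qed

end

section \<open>Strict equivalence and universality\<close>

lemma SL_subset_GL:
  assumes "g \<in> SL n"
  shows "g \<in> GL n"
proof -
  have g: "g \<in> carrier_mat n n" "det g = 1" using assms by (auto simp: SL_def)
  have "1 \<cdot>\<^sub>m 1\<^sub>m n = (1\<^sub>m n :: 'a mat)" by (intro eq_matI) auto
  then show ?thesis using adj_mat[OF g(1)] g
    by (auto simp: GL_def invertible_mat_def inverts_mat_def)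
qed

context chat_ring
begin

lemma mat_cong_one_iff:
  assumes "K \<in> carrier_mat n n"
  shows "mat_cong n (max_id \<pi>) K (1\<^sub>m n) \<longleftrightarrow> map_mat \<pi> K = 1\<^sub>m n"
  using assms by (auto simp: mat_cong_def max_id_def mat_eq_iff hom_minus split: if_splits)

lemma strict_equivI:
  assumes "\<rho> \<in> lifts n \<pi>R \<pi>" "\<rho>' \<in> lifts n \<pi>R \<pi>" "K \<in> carrier_mat n n" "L \<in> carrier_mat n n"
    "K * L = 1\<^sub>m n" "L * K = 1\<^sub>m n" "map_mat \<pi> K = 1\<^sub>m n" "\<And>g. g \<in> SL n \<Longrightarrow> \<rho>' g = K * \<rho> g * L"
  shows "(\<rho>, \<rho>') \<in> strict_equiv n \<pi>R \<pi>"
  unfolding strict_equiv_def using assms mat_cong_one_iff[OF assms(3)] by blast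

lemma strict_equivE:
  assumes "(\<rho>, \<rho>') \<in> strict_equiv n \<pi>R \<pi>"
  obtains K L where "\<rho> \<in> lifts n \<pi>R \<pi>" "\<rho>' \<in> lifts n \<pi>R \<pi>" "K \<in> carrier_mat n n" "L \<in> carrier_mat n n"
    "K * L = 1\<^sub>m n" "L * K = 1\<^sub>m n" "map_mat \<pi> K = 1\<^sub>m n" "\<And>g. g \<in> SL n \<Longrightarrow> \<rho>' g = K * \<rho> g * L"
  using assms mat_cong_one_iff unfolding strict_equiv_def by blast

lemma lifts_carrier: "\<rho> \<in> lifts n \<pi>R \<pi> \<Longrightarrow> g \<in> SL n \<Longrightarrow> \<rho> g \<in> carrier_mat n n"
  by (auto simp: lifts_def is_lift_def GL_def)

lemma conjugate_conjugate:
  fixes A :: "'s mat"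
  assumes "A \<in> carrier_mat n n" "K \<in> carrier_mat n n" "L \<in> carrier_mat n n" "K' \<in> carrier_mat n n" "L' \<in> carrier_mat n n"
  shows "K' * (K * A * L) * L' = (K' * K) * A * (L * L')"
  using assms by (simp add: assoc_mult_mat[of _ n n _ n _ n] mult_carrier_mat[of _ n n _ n])

lemma equiv_strict_equiv: "equiv (lifts n \<pi>R \<pi>) (strict_equiv n \<pi>R \<pi>)"
proof (rule equivI)
  show "strict_equiv n \<pi>R \<pi> \<subseteq> lifts n \<pi>R \<pi> \<times> lifts n \<pi>R \<pi>" by (auto simp: strict_equiv_def)
  have one: "map_mat \<pi> (1\<^sub>m n) = 1\<^sub>m n" by (intro eq_matI) auto
  show "refl_on (lifts n \<pi>R \<pi>) (strict_equiv n \<pi>R \<pi>)"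
    unfolding refl_on_def
    by (auto intro!: strict_equivI[of _ _ _ _ "1\<^sub>m n" "1\<^sub>m n"] simp: one)
       (metis left_mult_one_mat lifts_carrier right_mult_one_mat)
  show "sym (strict_equiv n \<pi>R \<pi>)"
  proof (rule symI)
    fix \<rho> \<rho>' assume "(\<rho>, \<rho>') \<in> strict_equiv n \<pi>R \<pi>"
    then show "(\<rho>', \<rho>) \<in> strict_equiv n \<pi>R \<pi>"
    proof (rule strict_equivE)
      fix K L
      assume h: "\<rho> \<in> lifts n \<pi>R \<pi>" "\<rho>' \<in> lifts n \<pi>R \<pi>" "K \<in> carrier_mat n n" "L \<in> carrier_mat n n"
        "K * L = 1\<^sub>m n" "L * K = 1\<^sub>m n" "map_mat \<pi> K = 1\<^sub>m n" "\<And>g. g \<in> SL n \<Longrightarrow> \<rho>' g = K * \<rho> g * L"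
      have "map_mat \<pi> (K * L) = map_mat \<pi> K * map_mat \<pi> L" by (rule mat_hom_mult[OF h(3,4)])
      then have "map_mat \<pi> L = 1\<^sub>m n" using h(4,5,7) one by simp
      moreover have "\<rho> g = L * \<rho>' g * K" if "g \<in> SL n" for g
        using conjugate_conjugate[OF lifts_carrier[OF h(1) that] h(3,4,4,3)] h(6) lifts_carrier[OF h(1) that]
        by (simp add: h(8)[OF that])
      ultimately show ?thesis using h by (intro strict_equivI[of _ _ _ _ L K])
    qed
  qed
  show "trans (strict_equiv n \<pi>R \<pi>)"
  proof (rule transI)
    fix \<rho>1 \<rho>2 \<rho>3
    assume "(\<rho>1, \<rho>2) \<in> strict_equiv n \<pi>R \<pi>" "(\<rho>2, \<rho>3) \<in> strict_equiv n \<pi>R \<pi>"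
    from strict_equivE[OF this(1)] obtain K L where h: "\<rho>1 \<in> lifts n \<pi>R \<pi>" "K \<in> carrier_mat n n" "L \<in> carrier_mat n n"
      "K * L = 1\<^sub>m n" "L * K = 1\<^sub>m n" "map_mat \<pi> K = 1\<^sub>m n" "\<And>g. g \<in> SL n \<Longrightarrow> \<rho>2 g = K * \<rho>1 g * L" by metis
    from strict_equivE[OF \<open>(\<rho>2, \<rho>3) \<in> strict_equiv n \<pi>R \<pi>\<close>] obtain K' L' where h': "\<rho>3 \<in> lifts n \<pi>R \<pi>"
      "K' \<in> carrier_mat n n" "L' \<in> carrier_mat n n" "K' * L' = 1\<^sub>m n" "L' * K' = 1\<^sub>m n" "map_mat \<pi> K' = 1\<^sub>m n"
      "\<And>g. g \<in> SL n \<Longrightarrow> \<rho>3 g = K' * \<rho>2 g * L'" by metis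
    show "(\<rho>1, \<rho>3) \<in> strict_equiv n \<pi>R \<pi>"
    proof (rule strict_equivI[of _ _ _ _ "K' * K" "L * L'"])
      show "(K' * K) * (L * L') = 1\<^sub>m n"
        using conjugate_conjugate[OF one_carrier_mat h(2,3) h'(2,3)] h h' by simp
      show "(L * L') * (K' * K) = 1\<^sub>m n"
        using conjugate_conjugate[OF one_carrier_mat h'(3,2) h(3,2)] h h' by simp
      show "map_mat \<pi> (K' * K) = 1\<^sub>m n" using h h' by (simp add: mat_hom_mult[OF h'(2) h(2)])
      show "\<rho>3 g = K' * K * \<rho>1 g * (L * L')" if "g \<in> SL n" for g
        using conjugate_conjugate[OF lifts_carrier[OF h(1) that] h(2,3) h'(2,3)] by (simp add: h(7)[OF that] h'(7)[OF that])
    qed (use h h' in \<open>auto intro: mult_carrier_mat\<close>)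
  qed
qed

end

section \<open>Lifts induced by ring homomorphisms, and the bijection with deformations\<close>

lemma is_lift_inclusion: "is_lift n \<pi>R \<pi>R (\<lambda>g. g)"
  by (auto simp: is_lift_def cont_rep_def SL_subset_GL)

text \<open>Continuity holds with i = j, since f carries m_R^j into m_S^j.\<close>

lemma is_lift_map_mat:
  assumes f: "Chat_hom \<pi>R \<pi>S f"
  shows "is_lift n \<pi>R \<pi>S (map_mat f)"
proof -
  interpret f: comm_ring_hom f using f by (intro is_ring_hom_comm_ring_hom) (simp add: Chat_hom_def)
  have "map_mat f g \<in> GL n" if "g \<in> SL n" for g
    using that by (intro SL_subset_GL) (auto simp: SL_def)
  moreover have "map_mat f (g * h) = map_mat f g * map_mat f h" if "g \<in> SL n" "h \<in> SL n" for g h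
    using that by (auto simp: SL_def intro: f.mat_hom_mult)
  moreover have "cont_rep n \<pi>R \<pi>S (map_mat f)"
    unfolding cont_rep_def
  proof (intro ballI allI)
    fix g :: "'a mat" and j assume g: "g \<in> SL n"
    have "mat_cong n (ideal_pow (max_id \<pi>S) j) (map_mat f h) (map_mat f g)"
      if "h \<in> SL n" "mat_cong n (ideal_pow (max_id \<pi>R) j) h g" for h
      using that g f ring_hom_image_ideal_pow[of f "max_id \<pi>R" "max_id \<pi>S" _ j]
      by (auto simp: mat_cong_def SL_def Chat_hom_def simp flip: f.hom_minus)
    then show "\<exists>i. \<forall>h\<in>SL n. mat_cong n (ideal_pow (max_id \<pi>R) i) h g \<longrightarrow>
      mat_cong n (ideal_pow (max_id \<pi>S) j) (map_mat f h) (map_mat f g)" by blast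
  qed
  moreover have "map_mat \<pi>S (map_mat f g) = map_mat \<pi>R g" if "g \<in> SL n" for g
    using f by (intro eq_matI) (auto simp: Chat_hom_def)
  ultimately show ?thesis by (simp add: is_lift_def)
qed

lemma Chat_hom_eqI:
  assumes S: "Chat_obj \<pi>S" and f: "Chat_hom \<pi>R \<pi>S f" and f': "Chat_hom \<pi>R \<pi>S f'" and n: "n \<ge> 2"
    and eq: "(map_mat f, map_mat f') \<in> strict_equiv n \<pi>R \<pi>S"
  shows "f = f'"
proof
  interpret chat_ring \<pi>S by (rule chat_ring.intro[OF S])
  interpret f: comm_ring_hom f using f by (intro is_ring_hom_comm_ring_hom) (simp add: Chat_hom_def)
  interpret f': comm_ring_hom f' using f' by (intro is_ring_hom_comm_ring_hom) (simp add: Chat_hom_def)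
  fix r
  from strict_equivE[OF eq] obtain K L where K: "K \<in> carrier_mat n n" "L \<in> carrier_mat n n" "L * K = 1\<^sub>m n"
    "map_mat \<pi>S K = 1\<^sub>m n" "\<And>g. g \<in> SL n \<Longrightarrow> map_mat f' g = K * map_mat f g * L" by metis
  \<comment> \<open>This is the entry at (0, 1) of the relation f'(t_01(r)) K = K
    f(t_01(r)).\<close>
  have key: "K $$ (0, 1) + K $$ (1, 1) * f' r = K $$ (0, 0) * f r + K $$ (0, 1)" for r
  proof -
    let ?t = "addrow_mat n r 0 1"
    have t: "?t \<in> SL n" using n by (intro addrow_mat_in_SL) auto
    have t': "map_mat f ?t \<in> carrier_mat n n" by simp
    have "map_mat f' ?t * K = K * map_mat f ?t * (L * K)"
      using K(1,2) t' unfolding K(5)[OF t] by (simp add: assoc_mult_mat[of _ n n _ n _ n] mult_carrier_mat[of _ n n _ n])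
    then have "map_mat f' ?t * K = K * map_mat f ?t" using K by (simp add: right_mult_one_mat[of _ n n])
    moreover have "map_mat f' ?t = addrow_mat n (f' r) 0 1" by (intro eq_matI) auto
    ultimately have "(addrow_mat n (f' r) 0 1 * K) $$ (0, 1) = (K * map_mat f ?t) $$ (0, 1)" by simp
    moreover have "(addrow_mat n (f' r) 0 1 * K) $$ (0, 1) = f' r * K $$ (1, 1) + K $$ (0, 1)"
      using K n by (subst index_addrow_mat_mult[of _ n n]) auto
    moreover have "(K * map_mat f ?t) $$ (0, 1) = (\<Sum>k<n. K $$ (0, k) * map_mat f ?t $$ (k, 1))"
      using K n by (intro index_mult_mat_sum) auto
    moreover have "\<dots> = (\<Sum>k<n. (if k = 0 then K $$ (0, 0) * f r else 0) + (if k = 1 then K $$ (0, 1) else 0))"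
      using n by (intro sum.cong) (auto simp: f.hom_add)
    ultimately show ?thesis using n by (simp add: sum.distrib ac_simps)
  qed
  have "map_mat \<pi>S K $$ (1, 1) = (1\<^sub>m n) $$ (1, 1)" by (simp add: K(4))
  then have "\<pi>S (K $$ (1, 1)) \<noteq> 0" using K(1) n by simp
  then obtain w where w: "K $$ (1, 1) * w = 1" using unit_iff by blast
  \<comment> \<open>At r = 1 both homomorphisms have value 1, so the two diagonal entries agree; as
    a unit, their common value can be cancelled for general r.\<close>
  have "K $$ (1, 1) = K $$ (0, 0)" using key[of 1] by (simp add: algebra_simps)
  then have "K $$ (1, 1) * f r = K $$ (1, 1) * f' r" using key[of r] by (simp add: algebra_simps)
  then have "w * (K $$ (1, 1) * f r) = w * (K $$ (1, 1) * f' r)" by simp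
  moreover have "w * (K $$ (1, 1) * x) = x" for x
  proof -
    have "w * (K $$ (1, 1) * x) = (K $$ (1, 1) * w) * x" by (simp only: ac_simps)
    then show ?thesis by (simp only: w mult_1_left)
  qed
  ultimately show "f r = f' r" by simp
qed

lemma lift_strict_equiv_map_mat:
  assumes R: "Chat_obj \<pi>R" and S: "Chat_obj \<pi>S" and n: "n \<ge> 4" and \<rho>: "is_lift n \<pi>R \<pi>S \<rho>"
  shows "\<exists>f. Chat_hom \<pi>R \<pi>S f \<and> (map_mat f, \<rho>) \<in> strict_equiv n \<pi>R \<pi>S"
proof -
  interpret R: chat_ring \<pi>R by (rule chat_ring.intro[OF R])
  interpret SL_rep \<pi>S n \<pi>R \<rho>
    using R S n \<rho> by unfold_locales (auto simp: is_lift_def Chat_obj_def)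
  interpret f: comm_ring_hom coeff by (rule is_ring_hom_comm_ring_hom[OF is_ring_hom_coeff])
  have f: "Chat_hom \<pi>R \<pi>S coeff"
    using is_ring_hom_coeff \<pi>_coeff by (auto simp: Chat_hom_def max_id_def)
  obtain L where L: "L \<in> carrier_mat n n" "K * L = 1\<^sub>m n" "L * K = 1\<^sub>m n"
    using residually_one_invertible[OF K_carrier \<pi>_K] by blast
  \<comment> \<open>The relation passes to products, so the elementary generators of SL_n(R)
    suffice.\<close>
  have intertwine: "\<rho> g * K = K * map_mat coeff g" if "g \<in> SL n" for g
    using that
  proof (induction rule: R.SL_elementary_induct)
    case one
    have "map_mat coeff (1\<^sub>m n) = 1\<^sub>m n" by (intro eq_matI) auto
    then show ?case using K_carrier by (simp add: \<rho>_one)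
  next
    case (step g i j r)
    let ?t = "addrow_mat n r i j"
    have t: "?t \<in> SL n" using step by (intro addrow_mat_in_SL)
    note c = \<rho>_carrier[OF t] \<rho>_carrier[OF step(1)] K_carrier
    have g: "g \<in> carrier_mat n n" using step by (simp add: SL_def)
    have c': "map_mat coeff ?t \<in> carrier_mat n n" "map_mat coeff g \<in> carrier_mat n n" using g by auto
    have "\<rho> (?t * g) * K = \<rho> ?t * (\<rho> g * K)" using c by (simp add: \<rho>_mult[OF t step(1)])
    also have "\<dots> = (\<rho> ?t * K) * map_mat coeff g" using c c' by (simp add: step(5))
    also have "\<dots> = K * (map_mat coeff ?t * map_mat coeff g)"
      unfolding intertwine_elementary[OF step(2-4)] by (rule assoc_mult_mat[OF c(3) c'])
    also have "\<dots> = K * map_mat coeff (?t * g)" using g by (simp add: f.mat_hom_mult[of _ n n _ n])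
    finally show ?case .
  qed
  have "\<rho> g = K * map_mat coeff g * L" if "g \<in> SL n" for g
  proof -
    have "\<rho> g = \<rho> g * (K * L)" using \<rho>_carrier[OF that] by (simp add: L)
    also have "\<dots> = \<rho> g * K * L" using \<rho>_carrier[OF that] K_carrier L by simp
    finally show ?thesis by (simp add: intertwine[OF that])
  qed
  then have "(map_mat coeff, \<rho>) \<in> strict_equiv n \<pi>R \<pi>S"
    using is_lift_map_mat[OF f] \<rho> K_carrier L \<pi>_K by (intro strict_equivI[of _ _ _ _ K L]) (auto simp: lifts_def)
  with f show ?thesis by blast
qed

text \<open>Bijectivity at an arbitrary object \<open>\<pi>S\<close> is the componentwise form of
  the natural isomorphism; compatibility with maps between objects is the functoriality of
  \<open>map_mat\<close>.\<close>

theorem mainTheorem3: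
  fixes \<pi>R :: "'r::comm_ring_1 \<Rightarrow> 'k::field"
    and \<pi>S :: "'s::comm_ring_1 \<Rightarrow> 'k"
    and n :: nat
  assumes k_finite: "finite (UNIV :: 'k set)"
    and R_obj: "Chat_obj \<pi>R"
    and n_ge: "n \<ge> 4"
    and S_obj: "Chat_obj \<pi>S"
  shows "is_lift n \<pi>R \<pi>R (\<lambda>g. g)
    \<and> bij_betw (push_class n \<pi>R \<pi>S (\<lambda>g. g)) {f. Chat_hom \<pi>R \<pi>S f} (Def_functor n \<pi>R \<pi>S)"
proof
  show "is_lift n \<pi>R \<pi>R (\<lambda>g. g)" by (rule is_lift_inclusion)
  interpret S: chat_ring \<pi>S by (rule chat_ring.intro[OF S_obj])
  let ?C = "push_class n \<pi>R \<pi>S (\<lambda>g. g)"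
  have C: "?C f = strict_equiv n \<pi>R \<pi>S `` {map_mat f}" for f by (simp add: push_class_def)
  note eqv = S.equiv_strict_equiv[of n \<pi>R]
  have lift: "map_mat f \<in> lifts n \<pi>R \<pi>S" if "Chat_hom \<pi>R \<pi>S f" for f
    using is_lift_map_mat[OF that] by (simp add: lifts_def)
  show "bij_betw ?C {f. Chat_hom \<pi>R \<pi>S f} (Def_functor n \<pi>R \<pi>S)"
    unfolding bij_betw_def
  proof (intro conjI equalityI)
    show "inj_on ?C {f. Chat_hom \<pi>R \<pi>S f}"
    proof (rule inj_onI)
      fix f f' assume "f \<in> {f. Chat_hom \<pi>R \<pi>S f}" "f' \<in> {f. Chat_hom \<pi>R \<pi>S f}" "?C f = ?C f'"
      then show "f = f'"
        \<comment> \<open>Equality of classes is turned into strict equivalence of the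
          representatives, which determines f.\<close>
        using Chat_hom_eqI[OF S_obj, of \<pi>R f f' n] n_ge lift[of f] lift[of f']
        by (simp add: C eq_equiv_class_iff[OF eqv])
    qed
    show "?C ` {f. Chat_hom \<pi>R \<pi>S f} \<subseteq> Def_functor n \<pi>R \<pi>S"
      using lift by (auto simp: C Def_functor_def intro: quotientI)
    show "Def_functor n \<pi>R \<pi>S \<subseteq> ?C ` {f. Chat_hom \<pi>R \<pi>S f}"
    proof
      fix c assume "c \<in> Def_functor n \<pi>R \<pi>S"
      then obtain \<rho> where \<rho>: "is_lift n \<pi>R \<pi>S \<rho>" "c = strict_equiv n \<pi>R \<pi>S `` {\<rho>}"
        by (auto simp: Def_functor_def lifts_def elim: quotientE)
      then obtain f where "Chat_hom \<pi>R \<pi>S f" "(map_mat f, \<rho>) \<in> strict_equiv n \<pi>R \<pi>S"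
        using lift_strict_equiv_map_mat[OF R_obj S_obj n_ge] by blast
      then show "c \<in> ?C ` {f. Chat_hom \<pi>R \<pi>S f}"
        using \<rho>(2) equiv_class_eq[OF eqv] by (auto simp: C)
    qed
  qed
qed

end
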